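(* For a free-infinitely divisible Voiculescu transform $$V_{\psi_{\tilde C}}(it)=i\left[\frac{t^2}{2}\,\zeta(2,t/2)-\frac{t^2}{4}\,\zeta(2,t/4)+1\right],\qquad t\neq 0,$$ we have that in its representation $$V_{\psi_{\tilde C}}(it)=a_{\psi_{\tilde C}}+\int_{\mathbb{R}}\frac{1+itx}{it-x}\,m_{\psi_{\tilde C}}(dx),\qquad t\neq 0,$$ the parameter is $a_{\psi_{\tilde C}}=0$, the total mass is $m_{\psi_{\tilde C}}(\mathbb{R})=2C-1\ (\approx 0.83193)$, where $C$ is Catalan's constant, and the measure $m_{\psi_{\tilde C}}$ has the characteristic function $$\hat m_{\psi_{\tilde C}}(t)=-1-t\tanh(t)-\cosh(t)\left(i\left(Li_2(ie^t)-Li_2(-ie^t)\right)+2t\arctan(e^t)\right)=\frac{\pi}{2}\int_0^\infty\cos(tx)\,\frac{x^2}{1+x^2}\,\frac{\cosh(\pi x/2)}{\sinh^2(\pi x/2)}\,dx .$$ In particular, we have $$i\left(Li_2(ie^t)-Li_2(-ie^t)\right)=2\sum_{k=1}^\infty(-1)^k\frac{e^{(2k-1)t}}{(2k-1)^2};\qquad i\left(Li_2(i)-Li_2(-i)\right)=-2C .$$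
   Context: Voiculescu transforms are considered only on the imaginary axis without zero, $i(\mathbb{R}\setminus\{0\})$. In the representation, $a_{\psi_{\tilde C}}\in\mathbb{R}$ and $m_{\psi_{\tilde C}}$ is a non-negative, finite Borel measure on $\mathbb{R}$; its characteristic function is $\hat m_{\psi_{\tilde C}}(t)=\int_{\mathbb{R}}e^{itx}\,m_{\psi_{\tilde C}}(dx)$. The index $\psi_{\tilde C}$ refers to the free-probability analogue of the background driving characteristic function $\psi_C(t)=\exp[t(\log\phi_C(t))']$ of the selfdecomposable hyperbolic cosine characteristic function $\phi_C(t)=1/\cosh(t)$. The Riemann (Hurwitz) zeta function is $\zeta(s,a)=\sum_{k=0}^\infty\frac{1}{(k+a)^s}$, $\Re s>1$, $-a\notin\mathbb{N}$; for $\Re a>0$ one has $\zeta(2,a)=\int_0^\infty\frac{x}{1-e^{-x}}e^{-ax}\,dx$. The polylogarithm functions are defined via the series $Li_n(z)=\sum_{k=1}^\infty\frac{z^k}{k^n}\equiv z\,\Phi(z,n,1)$, $z\in\mathbb{C}$, where $\Phi$ is the Lerch function; in particular $\frac{d}{dz}Li_2(z)=-z^{-1}\log(1-z)$. Catalan's constant is $C=\sum_{k=0}^\infty\frac{(-1)^k}{(2k+1)^2}\approx 0.9159$.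
   Formalization: The series for i(Li_2(ie^t)−Li_2(−ie^t)) is claimed only for t ≤ 0, as it diverges for t > 0; Li_2 is the analytically continued principal branch; the formula for V(it) is assumed only for t > 0, as it has poles at some t < 0, where V(−it) is the conjugate of V(it). *)

theory Defs
  imports "HOL-Probability.Probability" "HOL-Complex_Analysis.Complex_Analysis"
begin

section \<open>Voiculescu transforms and free infinite divisibility\<close>

definition cauchy_transform :: "real measure \<Rightarrow> complex \<Rightarrow> complex" where
  "cauchy_transform \<mu> z = (CLINT x|\<mu>. 1 / (z - of_real x))"

definition recip_cauchy_transform :: "real measure \<Rightarrow> complex \<Rightarrow> complex" where
  "recip_cauchy_transform \<mu> z = 1 / cauchy_transform \<mu> z"

definition stolz_angle :: "real \<Rightarrow> real \<Rightarrow> complex set" where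
  "stolz_angle \<alpha> \<beta> = {z. Im z > \<beta> \<and> \<bar>Re z\<bar> < \<alpha> * Im z}"

text \<open>
  Write \<open>F = 1 / G\<close> for the reciprocal Cauchy transform of \<open>\<mu>\<close>.
  The Voiculescu transform of \<open>\<mu>\<close> is \<open>z \<mapsto> F\<^sup>-\<^sup>1(z) - z\<close>, where the inverse is
  that of \<open>F\<close> restricted to a truncated cone on which it is injective. It is determined only on a
  truncated cone, so the predicate below leaves the values of \<open>V\<close> elsewhere unconstrained.
\<close>

definition has_voiculescu_transform :: "real measure \<Rightarrow> (complex \<Rightarrow> complex) \<Rightarrow> bool" where
  "has_voiculescu_transform \<mu> V \<longleftrightarrow>
     (\<exists>\<alpha> \<beta> \<gamma> \<delta>. \<alpha> > 0 \<and> \<beta> > 0 \<and> \<gamma> > 0 \<and> \<delta> > 0 \<and>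
        inj_on (recip_cauchy_transform \<mu>) (stolz_angle \<alpha> \<beta>) \<and>
        stolz_angle \<gamma> \<delta> \<subseteq> recip_cauchy_transform \<mu> ` stolz_angle \<alpha> \<beta> \<and>
        (\<forall>z \<in> stolz_angle \<gamma> \<delta>.
           V z = inv_into (stolz_angle \<alpha> \<beta>) (recip_cauchy_transform \<mu>) z - z))"

text \<open>
  Free additive convolution is the operation that adds Voiculescu transforms, so \<open>\<nu>\<close>
  below is an \<open>n\<close>-th free convolution root of \<open>\<mu>\<close>.
\<close>

definition free_infinitely_divisible :: "real measure \<Rightarrow> bool" where
  "free_infinitely_divisible \<mu> \<longleftrightarrow>
     (\<forall>n::nat. n \<ge> 1 \<longrightarrow>
        (\<exists>\<nu> W. real_distribution \<nu> \<and> has_voiculescu_transform \<nu> W \<and>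
               has_voiculescu_transform \<mu> (\<lambda>z. of_nat n * W z)))"

text \<open>
  The Voiculescu transform of a free-infinitely divisible law extends analytically to the upper
  half-plane, and by reflection to the lower one; \<open>V\<close> is this extension.
\<close>

definition free_id_voiculescu_transform :: "(complex \<Rightarrow> complex) \<Rightarrow> bool" where
  "free_id_voiculescu_transform V \<longleftrightarrow>
     V holomorphic_on {z. Im z \<noteq> 0} \<and>
     (\<forall>z. Im z \<noteq> 0 \<longrightarrow> V (cnj z) = cnj (V z)) \<and>
     (\<exists>\<mu>. real_distribution \<mu> \<and> free_infinitely_divisible \<mu> \<and> has_voiculescu_transform \<mu> V)"

definition voiculescu_representation ::
    "(complex \<Rightarrow> complex) \<Rightarrow> real \<Rightarrow> real measure \<Rightarrow> bool" where
  "voiculescu_representation V a m \<longleftrightarrow>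
     finite_borel_measure m \<and>
     (\<forall>t::real. t \<noteq> 0 \<longrightarrow>
        V (\<i> * of_real t) =
          of_real a + (CLINT x|m. (1 + \<i> * of_real t * of_real x) / (\<i> * of_real t - of_real x)))"


section \<open>Special functions\<close>

definition hurwitz_zeta :: "complex \<Rightarrow> complex \<Rightarrow> complex" where
  "hurwitz_zeta s a = (\<Sum>k. 1 / (of_nat k + a) powr s)"

definition catalan_const :: real where
  "catalan_const = (\<Sum>k. (-1) ^ k / (2 * real k + 1) ^ 2)"

definition polylog_series :: "nat \<Rightarrow> complex \<Rightarrow> complex" where
  "polylog_series n z = (\<Sum>k. z ^ Suc k / of_nat (Suc k) ^ n)"

definition slit_plane :: "complex set" where
  "slit_plane = - (of_real ` {1::real..})"

text \<open>
  Outside the unit disc the polylogarithm is the analytic continuation of its series to the plane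
  cut along \<open>[1, \<infinity>)\<close>, i.e. the principal branch. On the cut itself the value is unspecified.
\<close>

definition polylog :: "nat \<Rightarrow> complex \<Rightarrow> complex" where
  "polylog n z =
     (THE w. \<exists>f. f holomorphic_on slit_plane \<and>
                 (\<forall>u \<in> ball 0 1. f u = polylog_series n u) \<and> w = f z)"


subsection \<open>The continuation exists and is unique\<close>

lemma open_slit_plane: "open slit_plane"
proof -
  have "of_real ` {1::real..} = {z::complex. Im z = 0} \<inter> {z. Re z \<ge> 1}"
    by (auto simp: complex_eq_iff image_iff)
  moreover have "closed ({z::complex. Im z = 0} \<inter> {z. Re z \<ge> 1})"
    by (intro closed_Int closed_Collect_eq closed_Collect_le continuous_intros)
  ultimately show ?thesis
    unfolding slit_plane_def by (metis open_Compl)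
qed

lemma starlike_slit_plane: "starlike slit_plane"
  unfolding starlike_def
proof (intro bexI ballI subsetI)
  show "0 \<in> slit_plane" by (auto simp: slit_plane_def)
  fix z w assume z: "z \<in> slit_plane" and "w \<in> closed_segment 0 z"
  then obtain u where u: "0 \<le> u" "u \<le> 1" "w = of_real u * z"
    by (auto simp: in_segment scaleR_conv_of_real)
  show "w \<in> slit_plane"
    unfolding slit_plane_def
  proof (rule ComplI)
    assume "w \<in> complex_of_real ` {1..}"
    then obtain r where r: "r \<ge> 1" "w = of_real r" by auto
    with u have "u > 0" by (cases "u = 0") auto
    with r u have "z = of_real (r / u)" by (simp add: field_simps)
    moreover have "r / u \<ge> 1" using r u \<open>u > 0\<close> by (simp add: field_simps)
    ultimately have "z \<in> of_real ` {1::real..}" by (metis atLeast_iff imageI)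
    then show False using z by (simp add: slit_plane_def)
  qed
qed

lemma ball_subset_slit_plane: "ball 0 1 \<subseteq> slit_plane"
  by (auto simp: slit_plane_def)

lemma summable_polylog_coeffs:
  fixes z :: complex
  assumes "norm z < 1"
  shows "summable (\<lambda>k. 1 / of_nat (Suc k) ^ n * z ^ k)"
proof (rule summable_comparison_test')
  show "summable (\<lambda>k. norm z ^ k)" using assms by (simp add: summable_geometric)
  fix k :: nat
  have "1 \<le> real (Suc k) ^ n" by (rule one_le_power) simp
  moreover have "norm (of_nat (Suc k) ^ n :: complex) = real (Suc k) ^ n"
    by (metis norm_of_nat norm_power)
  ultimately have "norm (1 / of_nat (Suc k) ^ n :: complex) \<le> 1"
    by (simp add: norm_divide del: of_nat_Suc)
  then have "norm (1 / of_nat (Suc k) ^ n :: complex) * norm z ^ k \<le> norm z ^ k"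
    by (intro mult_left_le_one_le) simp_all
  then show "norm (1 / of_nat (Suc k) ^ n * z ^ k) \<le> norm z ^ k"
    by (simp only: norm_mult norm_power)
qed

lemma polylog_quotient_continuation:
  "\<exists>g. g holomorphic_on slit_plane \<and>
       (\<forall>z \<in> ball 0 1. g z = (\<Sum>k. 1 / of_nat (Suc k) ^ n * z ^ k))"
proof (induction n)
  case 0
  have "(\<lambda>z. 1 / (1 - z)) holomorphic_on slit_plane"
    by (intro holomorphic_intros) (auto simp: slit_plane_def image_iff)
  moreover have "1 / (1 - z) = (\<Sum>k. 1 / of_nat (Suc k) ^ 0 * z ^ k)"
    if "z \<in> ball 0 1" for z :: complex
    using that suminf_geometric[of z] by simp
  ultimately show ?case by blast
next
  case (Suc n)
  then obtain g where g: "g holomorphic_on slit_plane"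
    "\<And>z. z \<in> ball 0 1 \<Longrightarrow> g z = (\<Sum>k. 1 / of_nat (Suc k) ^ n * z ^ k)"
    by blast
  have "\<exists>P. \<forall>z \<in> slit_plane. (P has_field_derivative g z) (at z)"
    by (rule holomorphic_starlike_primitive[where k = "{}"])
       (use g(1) open_slit_plane starlike_slit_plane in
          \<open>auto simp: holomorphic_on_imp_continuous_on holomorphic_on_imp_differentiable_at\<close>)
  then obtain P where P: "\<And>z. z \<in> slit_plane \<Longrightarrow> (P has_field_derivative g z) (at z)"
    by blast
  define Q where "Q = (\<lambda>z. P z - P 0)"
  have Q: "(Q has_field_derivative g z) (at z)" if "z \<in> slit_plane" for z
    unfolding Q_def using P[OF that] by (auto intro!: derivative_eq_intros)
  have Qh: "Q holomorphic_on slit_plane"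
    using Q open_slit_plane by (meson field_differentiable_def holomorphic_on_open)
  have z0: "0 \<in> slit_plane" using ball_subset_slit_plane by auto
  have dQ: "deriv Q 0 = g 0" using Q[OF z0] by (rule DERIV_imp_deriv)
  have at0: "(\<Sum>k. 1 / of_nat (Suc k) ^ j * 0 ^ k) = (1::complex)" for j
    using powser_zero[of "\<lambda>k. 1 / of_nat (Suc k) ^ j :: complex"] by simp
  have g0: "g 0 = 1" using g(2)[of 0] at0[of n] by simp
  define h where "h = (\<lambda>z. if z = 0 then deriv Q 0 else Q z / z)"
  have "h holomorphic_on slit_plane"
    by (rule pole_theorem_open_0[OF Qh open_slit_plane, of 0]) (auto simp: h_def Q_def)
  moreover have "h z = (\<Sum>k. 1 / of_nat (Suc k) ^ Suc n * z ^ k)" if z: "z \<in> ball 0 1" for z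
  proof (cases "z = 0")
    case True
    then show ?thesis using at0[of "Suc n"] by (simp only: h_def dQ g0) simp
  next
    case False
    define c :: "nat \<Rightarrow> complex" where "c = (\<lambda>k. if k = 0 then 0 else 1 / of_nat k ^ Suc n)"
    define S where "S = (\<lambda>w. \<Sum>k. c k * w ^ k)"
    have summ_c: "summable (\<lambda>k. c k * w ^ k)" if "norm w < 1" for w
    proof -
      have "summable (\<lambda>k. w * (1 / of_nat (Suc k) ^ Suc n * w ^ k))"
        by (intro summable_mult summable_polylog_coeffs that)
      then have "summable (\<lambda>k. c (Suc k) * w ^ Suc k)"
        by (simp add: c_def mult_ac del: of_nat_Suc)
      then show ?thesis by (subst summable_Suc_iff[symmetric])
    qed
    have dc: "diffs c k = 1 / of_nat (Suc k) ^ n" for k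
      unfolding diffs_def c_def by (simp add: field_simps del: of_nat_Suc)
    have dS: "(S has_field_derivative g w) (at w)" if w: "w \<in> ball 0 1" for w
    proof -
      have "(S has_field_derivative (\<Sum>k. diffs c k * w ^ k)) (at w)"
        unfolding S_def by (rule termdiffs_strong'[where K = 1]) (use w summ_c in auto)
      then show ?thesis using g(2)[OF w] by (simp only: dc)
    qed
    have "\<exists>b. \<forall>w \<in> ball 0 1. Q w - S w = b"
    proof (rule has_field_derivative_zero_constant)
      show "convex (ball (0::complex) 1)" by simp
      fix w :: complex assume w: "w \<in> ball 0 1"
      then have "w \<in> slit_plane" using ball_subset_slit_plane by blast
      have "((\<lambda>w. Q w - S w) has_field_derivative g w - g w) (at w)"
        by (intro DERIV_diff Q dS w \<open>w \<in> slit_plane\<close>)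
      then show "((\<lambda>w. Q w - S w) has_field_derivative 0) (at w within ball 0 1)"
        by (simp add: has_field_derivative_at_within)
    qed
    then obtain b where b: "\<And>w. w \<in> ball 0 1 \<Longrightarrow> Q w - S w = b" by blast
    have "S 0 = 0" by (simp add: S_def c_def)
    then have "b = 0" using b[of 0] by (simp add: Q_def)
    then have "Q z = S z" using b[OF z] by simp
    also have "S z = (\<Sum>k. c (Suc k) * z ^ Suc k)"
      unfolding S_def using suminf_split_head[OF summ_c, of z] z by (simp add: c_def)
    also have "\<dots> = (\<Sum>k. z * (1 / of_nat (Suc k) ^ Suc n * z ^ k))"
      by (simp add: c_def mult_ac del: of_nat_Suc)
    also have "\<dots> = z * (\<Sum>k. 1 / of_nat (Suc k) ^ Suc n * z ^ k)"
      by (rule suminf_mult, rule summable_polylog_coeffs) (use z in auto)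
    finally show ?thesis using False by (simp add: h_def del: of_nat_Suc)
  qed
  ultimately show ?case by blast
qed

lemma polylog_continuation:
  "\<exists>f. f holomorphic_on slit_plane \<and> (\<forall>u \<in> ball 0 1. f u = polylog_series n u)"
proof -
  obtain g where g: "g holomorphic_on slit_plane"
    "\<And>z. z \<in> ball 0 1 \<Longrightarrow> g z = (\<Sum>k. 1 / of_nat (Suc k) ^ n * z ^ k)"
    using polylog_quotient_continuation by blast
  have "z * g z = polylog_series n z" if z: "z \<in> ball 0 1" for z
  proof -
    have "z * g z = (\<Sum>k. z * (1 / of_nat (Suc k) ^ n * z ^ k))"
      unfolding g(2)[OF z]
      by (rule suminf_mult[symmetric], rule summable_polylog_coeffs) (use z in auto)
    then show ?thesis by (simp add: polylog_series_def del: of_nat_Suc)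
  qed
  moreover have "(\<lambda>z. z * g z) holomorphic_on slit_plane"
    using g(1) by (intro holomorphic_intros)
  ultimately show ?thesis by blast
qed

lemma polylog_eqI:
  assumes f: "f holomorphic_on slit_plane" "\<And>u. u \<in> ball 0 1 \<Longrightarrow> f u = polylog_series n u"
    and z: "z \<in> slit_plane"
  shows "polylog n z = f z"
  unfolding polylog_def
proof (rule the_equality)
  show "\<exists>h. h holomorphic_on slit_plane \<and>
            (\<forall>u \<in> ball 0 1. h u = polylog_series n u) \<and> f z = h z"
    using f by blast
next
  fix w assume "\<exists>h. h holomorphic_on slit_plane \<and>
            (\<forall>u \<in> ball 0 1. h u = polylog_series n u) \<and> w = h z"
  then obtain h where h: "h holomorphic_on slit_plane"
    "\<And>u. u \<in> ball 0 1 \<Longrightarrow> h u = polylog_series n u" "w = h z"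
    by blast
  have "h z = f z"
    using open_ball open_slit_plane _ starlike_imp_connected[OF starlike_slit_plane]
      ball_subset_slit_plane h(1) f(1) _ z
    by (rule analytic_continuation_open) (use f(2) h(2) in auto)
  with h(3) show "w = f z" by simp
qed

lemma holomorphic_polylog: "polylog n holomorphic_on slit_plane"
  and polylog_eq_series: "norm z < 1 \<Longrightarrow> polylog n z = polylog_series n z"
proof -
  obtain f where f: "f holomorphic_on slit_plane"
    "\<And>u. u \<in> ball 0 1 \<Longrightarrow> f u = polylog_series n u"
    using polylog_continuation by blast
  have eq: "polylog n u = f u" if "u \<in> slit_plane" for u
    using polylog_eqI[OF f that] .
  show "polylog n holomorphic_on slit_plane"
    using f(1) by (rule holomorphic_transform) (simp add: eq)
  show "norm z < 1 \<Longrightarrow> polylog n z = polylog_series n z"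
    using eq[of z] f(2)[of z] ball_subset_slit_plane by auto
qed

end

theory Submission
  imports Defs
begin

text \<open>
  On the imaginary axis everything reduces to Laplace transforms. Division with remainder gives, for
  \<open>t > 0\<close>, \<open>(1 + itx) / (it - x) = - it - i (1 - t\<^sup>2) cnj (1 / (t - ix))\<close>, and \<open>1 / (t - ix)\<close> is the Laplace
  transform of \<open>u \<mapsto> exp (iux)\<close> at \<open>t\<close>. So the integral against \<open>m\<close> is an expression in the total mass and
  in the Laplace transform of the characteristic function of \<open>m\<close> (\<open>representation_integral\<close>). The
  value at \<open>t = 1\<close> yields \<open>a\<close> and the mass, the values at \<open>t > 1\<close> yield the Laplace transform, and a
  continuous function of exponential growth is determined by its Laplace transform on an arithmetic
  progression (\<open>laplace_eq_0_imp_eq_0\<close>). Hence \<open>a\<close>, the mass and the characteristic function are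
  determined by \<open>V\<close> (\<open>voiculescu_representation_unique\<close>), and it suffices to study one representing
  measure.

  That measure has density \<open>K x / (2 (1 + x\<^sup>2))\<close>, where
  \<open>K x = \<pi>/2 x\<^sup>2 cosh (\<pi>x/2) / (sinh (\<pi>x/2))\<^sup>2\<close>. The decisive fact is that the Fourier transform of \<open>K/2\<close>
  is the second derivative of \<open>t tanh t\<close> (\<open>char_kernel_measure\<close>): expanding \<open>K\<close> into decaying
  exponentials leads to polygamma values at \<open>1/2 - it/\<pi>\<close> and \<open>1/2 + it/\<pi>\<close>, and the reflection formulas
  combine them. The kernel of the representation absorbs the factor \<open>1 / (1 + x\<^sup>2)\<close>, so the measure
  represents the function with value \<open>- i L(t)\<close> at \<open>it\<close>, where \<open>L\<close> is the Laplace transform of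
  \<open>(t tanh t)''\<close>. Integrating by parts twice and expanding \<open>tanh\<close> into a geometric series yields
  \<open>L(t) = 2 t\<^sup>2 \<Sum>k. (-1)\<^sup>k / (t + 2k)\<^sup>2 - 1\<close> (\<open>laplace_x_tanh_deriv2\<close>). Separating even and odd \<open>k\<close> turns
  this into the two Hurwitz zeta values, and \<open>t = 1\<close> gives the mass \<open>2 C - 1\<close>.

  For the closed form, put \<open>F t = i (Li\<^sub>2 (i exp t) - Li\<^sub>2 (- i exp t)) + 2 t arctan (exp t)\<close>. Since
  \<open>z Li\<^sub>2' z = - ln (1 - z)\<close>, the first summand has derivative \<open>- 2 arctan (exp t)\<close>, and so
  \<open>F' t = t / cosh t\<close>. Therefore \<open>\<phi> t = - 1 - t tanh t - cosh t F t\<close> solves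
  \<open>\<phi> - \<phi>'' = (t tanh t)''\<close> with \<open>\<phi> 0 = 2 C - 1\<close> and \<open>\<phi>' 0 = 0\<close>. This fixes its Laplace transform, which is
  that of the characteristic function, and injectivity of the Laplace transform applies once more.
  The value \<open>F 0 = - 2 C\<close> comes from the dilogarithm series on the unit circle, where it still
  represents the continuation.
\<close>

section \<open>Integrals over the half-line\<close>

lemma half_line_FTC:
  fixes F f :: "real \<Rightarrow> complex"
  assumes F: "\<And>x. x > 0 \<Longrightarrow> (F has_vector_derivative f x) (at x)"
    and f: "continuous_on {0<..} f"
    and int: "set_integrable lborel {0<..} f"
    and A: "(F \<longlongrightarrow> A) (at_right 0)" and B: "(F \<longlongrightarrow> B) at_top"
  shows "(LINT x:{0<..}|lborel. f x) = B - A"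
proof -
  have "(LBINT x=ereal 0..\<infinity>. f x) = B - A"
  proof (rule interval_integral_FTC_integrable)
    show "isCont f x" if "ereal 0 < ereal x" for x
      using f that by (simp add: continuous_on_eq_continuous_at)
    show "set_integrable lborel (einterval (ereal 0) \<infinity>) f"
      using int by simp
    show "((F \<circ> real_of_ereal) \<longlongrightarrow> A) (at_right (ereal 0))"
      using A by (simp add: ereal_tendsto_simps)
    show "((F \<circ> real_of_ereal) \<longlongrightarrow> B) (at_left \<infinity>)"
      using B by (simp add: ereal_tendsto_simps)
  qed (use F in auto)
  then show ?thesis by (simp only: interval_integral_to_infinity_eq)
qed

lemma set_integrable_power_times_exp:
  fixes a :: real
  assumes "a > 0"
  shows "set_integrable lborel {0<..} (\<lambda>x. x ^ n * exp (- (a * x)))"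
proof -
  interpret prob_space "density lborel (erlang_density n a)"
    using assms by (rule prob_space_erlang_density)
  have "(\<integral>\<^sup>+x. ennreal (erlang_density n a x) \<partial>lborel) = 1"
    using emeasure_space_1 by (simp add: emeasure_density)
  then have "integrable lborel (erlang_density n a)"
    using assms by (intro integrableI_nonneg) (auto simp: erlang_density_nonneg)
  then have "integrable lborel (\<lambda>x. fact n / a ^ Suc n * erlang_density n a x)"
    by (rule integrable_mult_right)
  also have "(\<lambda>x. fact n / a ^ Suc n * erlang_density n a x)
      = (\<lambda>x. indicator {0..} x *\<^sub>R (x ^ n * exp (- (a * x))))"
    using assms by (auto simp: erlang_density_def fun_eq_iff indicator_def)
  finally have "set_integrable lborel {0..} (\<lambda>x. x ^ n * exp (- (a * x)))"
    unfolding set_integrable_def .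
  then show ?thesis by (rule set_integrable_subset) auto
qed

lemma tendsto_power_times_exp_at_top:
  fixes a :: real
  assumes "a > 0"
  shows "((\<lambda>x. x ^ n * exp (- (a * x))) \<longlongrightarrow> 0) at_top"
proof -
  have "((\<lambda>x. (a * x) ^ n / exp (a * x)) \<longlongrightarrow> 0) at_top"
    by (rule filterlim_compose[OF tendsto_power_div_exp_0])
       (rule filterlim_tendsto_pos_mult_at_top[OF tendsto_const assms filterlim_ident])
  then have "((\<lambda>x. (1 / a ^ n) * ((a * x) ^ n / exp (a * x))) \<longlongrightarrow> (1 / a ^ n) * 0) at_top"
    by (intro tendsto_intros)
  then show ?thesis
    using assms by (simp add: power_mult_distrib exp_minus field_simps)
qed

text \<open>
  Induction on the exponent: \<open>x\<^sup>n\<^sup>+\<^sup>1 exp (- c x)\<close> vanishes at both ends, so integrating its derivative relates consecutive exponents.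
\<close>

lemma integral_power_times_exp:
  fixes c :: complex
  assumes c: "Re c > 0"
  shows "set_integrable lborel {0<..} (\<lambda>x. of_real x ^ n * exp (- (c * of_real x)))" (is ?I)
    and "(LINT x:{0<..}|lborel. of_real x ^ n * exp (- (c * of_real x))) = fact n / c ^ Suc n"
      (is "?J n")
proof -
  have int: "set_integrable lborel {0<..} (\<lambda>x. of_real x ^ n * exp (- (c * of_real x)))" for n
  proof (rule set_integrable_bound[OF set_integrable_power_times_exp[OF c, of n]])
    show "set_borel_measurable lborel {0<..} (\<lambda>x. of_real x ^ n * exp (- (c * of_real x)))"
      unfolding set_borel_measurable_def by measurable
  qed (auto simp: norm_mult norm_power)
  then show ?I .
  have lim: "((\<lambda>x. of_real x ^ n * exp (- (c * of_real x))) \<longlongrightarrow> 0) at_top" for n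
  proof (rule tendsto_norm_zero_cancel, rule Lim_transform_eventually)
    show "((\<lambda>x. x ^ n * exp (- (Re c * x))) \<longlongrightarrow> 0) at_top"
      using c by (rule tendsto_power_times_exp_at_top)
    show "\<forall>\<^sub>F x in at_top. x ^ n * exp (- (Re c * x))
        = norm (of_real x ^ n * exp (- (c * of_real x)))"
      using eventually_ge_at_top[of 0] by eventually_elim (simp add: norm_mult norm_power)
  qed
  have c0: "c \<noteq> 0" using c by auto
  show "?J n"
  proof (induction n)
    case 0
    have "(LINT x:{0<..}|lborel. of_real x ^ 0 * exp (- (c * of_real x)))
        = 0 - (- (exp (- (c * of_real 0)) / c))"
    proof (rule half_line_FTC[where F = "\<lambda>x. - (exp (- (c * of_real x)) / c)"])
      show "((\<lambda>x. - (exp (- (c * of_real x)) / c)) \<longlongrightarrow> 0) at_top"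
        using tendsto_minus[OF tendsto_divide[OF lim[of 0] tendsto_const, of c]] c0 by simp
      show "((\<lambda>x. - (exp (- (c * of_real x)) / c)) \<longlongrightarrow> - (exp (- (c * of_real 0)) / c)) (at_right 0)"
        using c0 by (intro tendsto_intros) auto
      show "((\<lambda>x. - (exp (- (c * of_real x)) / c)) has_vector_derivative
          of_real x ^ 0 * exp (- (c * of_real x))) (at x)" for x
        using c0 by (auto intro!: has_vector_derivative_real_field derivative_eq_intros)
    qed (auto intro!: continuous_intros int[of 0, simplified])
    then show ?case by simp
  next
    case (Suc n)
    define F where "F = (\<lambda>z. - (z ^ Suc n * exp (- (c * z)) / c))"
    define g where "g = (\<lambda>n x. complex_of_real x ^ n * exp (- (c * of_real x)))"
    have int_g: "set_integrable lborel {0<..} (g n)" for n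
      unfolding g_def by (rule int)
    have "(LINT x:{0<..}|lborel. g (Suc n) x - of_nat (Suc n) / c * g n x) = 0 - F (of_real 0)"
    proof (rule half_line_FTC[where F = "\<lambda>x. F (of_real x)"])
      have "(F has_field_derivative z ^ Suc n * exp (- (c * z)) - of_nat (Suc n) / c * (z ^ n * exp (- (c * z)))) (at z)" for z
      proof -
        have "((\<lambda>z. z ^ Suc n) has_field_derivative of_nat (Suc n) * z ^ n) (at z)"
          using DERIV_power[OF DERIV_ident, where n = "Suc n"] by (simp del: power_Suc of_nat_Suc)
        moreover have "((\<lambda>z. exp (- (c * z))) has_field_derivative - c * exp (- (c * z))) (at z)"
          by (auto intro!: derivative_eq_intros)
        ultimately have "((\<lambda>z. z ^ Suc n * exp (- (c * z))) has_field_derivative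
            z ^ Suc n * (- c * exp (- (c * z))) + of_nat (Suc n) * z ^ n * exp (- (c * z))) (at z)"
          by (rule DERIV_mult')
        from DERIV_minus[OF DERIV_cdivide[OF this, of c]] show ?thesis
          unfolding F_def by (rule DERIV_cong) (use c0 in \<open>simp add: field_simps del: of_nat_Suc\<close>)
      qed
      then show "((\<lambda>x. F (of_real x)) has_vector_derivative
          g (Suc n) x - of_nat (Suc n) / c * g n x) (at x)" for x
        unfolding g_def by (intro has_vector_derivative_real_field)
      show "((\<lambda>x. F (of_real x)) \<longlongrightarrow> 0) at_top"
        using tendsto_minus[OF tendsto_divide[OF lim[of "Suc n"] tendsto_const, of c]] c0
        by (simp add: F_def)
      show "((\<lambda>x. F (of_real x)) \<longlongrightarrow> F (of_real 0)) (at_right 0)"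
        unfolding F_def using c0 by (intro tendsto_intros) auto
      show "continuous_on {0<..} (\<lambda>x. g (Suc n) x - of_nat (Suc n) / c * g n x)"
        unfolding g_def by (intro continuous_intros)
      show "set_integrable lborel {0<..} (\<lambda>x. g (Suc n) x - of_nat (Suc n) / c * g n x)"
        by (intro set_integral_diff set_integrable_mult_right int_g)
    qed
    also have "(LINT x:{0<..}|lborel. g (Suc n) x - of_nat (Suc n) / c * g n x)
        = (LINT x:{0<..}|lborel. g (Suc n) x) - of_nat (Suc n) / c * (LINT x:{0<..}|lborel. g n x)"
      by (subst set_integral_diff) (auto intro!: set_integrable_mult_right int_g)
    also have "(LINT x:{0<..}|lborel. g n x) = fact n / c ^ Suc n"
      using Suc.IH by (simp only: g_def)
    finally have "(LINT x:{0<..}|lborel. g (Suc n) x) = of_nat (Suc n) / c * (fact n / c ^ Suc n)"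
      by (simp add: F_def)
    then show ?case
      by (simp add: g_def)
  qed
qed

lemma integral_real_power_times_exp:
  fixes a :: real
  assumes a: "a > 0"
  shows "(LINT x:{0<..}|lborel. x ^ n * exp (- (a * x))) = fact n / a ^ Suc n"
proof -
  have "complex_of_real (LINT x:{0<..}|lborel. x ^ n * exp (- (a * x)))
      = (LINT x:{0<..}|lborel. of_real x ^ n * exp (- (of_real a * of_real x)))"
    by (subst set_integral_complex_of_real[symmetric]) (simp add: exp_of_real[symmetric])
  also have "\<dots> = fact n / of_real a ^ Suc n"
    using a by (intro integral_power_times_exp) simp
  also have "\<dots> = complex_of_real (fact n / a ^ Suc n)" by simp
  finally show ?thesis unfolding of_real_eq_iff .
qed

section \<open>Laplace transforms\<close>

definition laplace :: "(real \<Rightarrow> complex) \<Rightarrow> real \<Rightarrow> complex" where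
  "laplace f s = (LINT u:{0<..}|lborel. of_real (exp (- (s * u))) * f u)"

lemma set_integrable_laplace:
  fixes f :: "real \<Rightarrow> complex"
  assumes f: "continuous_on UNIV f" and bound: "\<And>u. u > 0 \<Longrightarrow> norm (f u) \<le> B * exp (c * u)"
    and s: "c < s"
  shows "set_integrable lborel {0<..} (\<lambda>u. of_real (exp (- (s * u))) * f u)"
proof -
  have "set_integrable lborel {0<..} (\<lambda>u. u ^ 0 * exp (- ((s - c) * u)))"
    using s by (intro set_integrable_power_times_exp) auto
  then have 1: "set_integrable lborel {0<..} (\<lambda>u. B * exp (- ((s - c) * u)))"
    by (intro set_integrable_mult_right) simp
  have "f \<in> borel_measurable borel" using f by (rule borel_measurable_continuous_onI)
  then have 2: "set_borel_measurable lborel {0<..} (\<lambda>u. of_real (exp (- (s * u))) * f u)"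
    unfolding set_borel_measurable_def by measurable
  have "norm (of_real (exp (- (s * u))) * f u) \<le> norm (B * exp (- ((s - c) * u)))" if "u > 0" for u
  proof -
    have "norm (of_real (exp (- (s * u))) * f u) \<le> exp (- (s * u)) * (B * exp (c * u))"
      using bound[OF that] by (simp add: norm_mult mult_left_mono)
    also have "\<dots> = B * exp (- ((s - c) * u))" by (simp add: algebra_simps exp_add exp_diff exp_minus field_simps)
    finally show ?thesis by simp
  qed
  then show ?thesis
    by (intro set_integrable_bound[OF 1 2] AE_I2) simp
qed

text \<open>
  The integrand is non-negative and continuous, and a non-empty open set is not negligible.
\<close>

lemma continuous_eq_0_of_weighted_square_integral:
  fixes h w :: "real \<Rightarrow> real"
  assumes h: "continuous_on UNIV h" and w: "\<And>u. w u > 0"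
    and int: "set_integrable lborel {0<..} (\<lambda>u. w u * (h u)\<^sup>2)"
    and zero: "(LINT u:{0<..}|lborel. w u * (h u)\<^sup>2) = 0" and u: "u \<ge> 0"
  shows "h u = 0"
proof -
  have "AE u in lborel. indicator {0<..} u *\<^sub>R (w u * (h u)\<^sup>2) = 0"
  proof (subst integral_nonneg_eq_0_iff_AE[symmetric])
    show "AE u in lborel. 0 \<le> indicator {0<..} u *\<^sub>R (w u * (h u)\<^sup>2)"
      using w by (intro AE_I2) (auto simp: less_imp_le)
    show "integrable lborel (\<lambda>u. indicator {0<..} u *\<^sub>R (w u * (h u)\<^sup>2))"
      using int by (simp add: set_integrable_def)
    show "(LINT u|lborel. indicator {0<..} u *\<^sub>R (w u * (h u)\<^sup>2)) = 0"
      using zero by (simp add: set_lebesgue_integral_def)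
  qed
  then have ae: "AE u in lborel. u > 0 \<longrightarrow> h u = 0"
  proof eventually_elim
    case (elim u)
    then show ?case using w[of u] by auto
  qed
  define U where "U = {0<..} \<inter> {u. h u \<noteq> 0}"
  have "open U" unfolding U_def
    by (intro open_Int open_Collect_neq continuous_intros h open_greaterThan)
  moreover have "negligible U"
  proof -
    have "U \<in> sets borel" using \<open>open U\<close> by simp
    then have "U \<in> null_sets lborel"
      using ae by (subst AE_iff_null_sets) (auto simp: U_def elim!: eventually_mono)
    then show ?thesis
      by (simp add: negligible_iff_null_sets null_sets_completionI)
  qed
  ultimately have "U = {}" using open_not_negligible by blast
  then have pos: "h u = 0" if "u > 0" for u using that by (auto simp: U_def)
  have "h 0 = 0"
  proof (rule tendsto_unique)
    show "(h \<longlongrightarrow> h 0) (at_right 0)"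
      using h by (simp add: continuous_on_eq_continuous_at isCont_def filterlim_at_split)
    show "(h \<longlongrightarrow> 0) (at_right 0)"
      by (rule Lim_transform_eventually[OF tendsto_const])
         (auto simp: eventually_at_right_field pos intro!: exI[of _ 1])
  qed simp
  with pos u show ?thesis by (cases "u = 0") auto
qed

text \<open>
  Lerch's theorem for bounded functions. In the variable \<open>y = exp (- u)\<close> the hypothesis says that \<open>exp (- u) h u\<close>, a
  continuous function \<open>\<phi>\<close> of \<open>y\<close> on the unit interval, is orthogonal to all polynomials in \<open>y\<close> with respect to \<open>du\<close>. As \<open>\<phi>\<close> is a uniform
  limit of polynomials, it is orthogonal to itself.
\<close>

lemma laplace_zero_imp_zero_real:
  fixes h :: "real \<Rightarrow> real"
  assumes h: "continuous_on UNIV h" and bound: "\<And>u. u \<ge> 0 \<Longrightarrow> \<bar>h u\<bar> \<le> B"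
    and zero: "\<And>n. (LINT u:{0<..}|lborel. exp (- (real (Suc n) * u)) * h u) = 0"
    and u: "u \<ge> 0"
  shows "h u = 0"
proof -
  have B: "B \<ge> 0" using bound[of 0] by linarith
  have [measurable]: "h \<in> borel_measurable borel"
    using h by (rule borel_measurable_continuous_onI)
  have int_exp: "set_integrable lborel {0<..} (\<lambda>u. B * exp (- u))" for B :: real
    using set_integrable_power_times_exp[of 1 0] by (intro set_integrable_mult_right) simp
  have int_bound: "set_integrable lborel {0<..} (\<lambda>u. exp (- u) * h u * g u)"
    if [measurable]: "g \<in> borel_measurable borel" and g: "\<And>u. u > 0 \<Longrightarrow> \<bar>g u\<bar> \<le> M" for g M
  proof (rule set_integrable_bound[OF int_exp[of "B * M"]])
    show "set_borel_measurable lborel {0<..} (\<lambda>u. exp (- u) * h u * g u)"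
      unfolding set_borel_measurable_def by measurable
    have "\<bar>h u\<bar> * \<bar>g u\<bar> \<le> B * M" if "u > 0" for u
      using that B bound[of u] g[OF that] by (intro mult_mono) auto
    then have "exp (- u) * (\<bar>h u\<bar> * \<bar>g u\<bar>) \<le> exp (- u) * \<bar>B * M\<bar>" if "u > 0" for u
      using that by (intro mult_left_mono order_trans[OF _ abs_ge_self]) auto
    then have "\<bar>exp (- u) * h u * g u\<bar> \<le> \<bar>B * M * exp (- u)\<bar>" if "u > 0" for u
      using that by (simp only: abs_mult mult_ac abs_exp_cancel)
    then show "AE u in lborel. u \<in> {0<..} \<longrightarrow> norm (exp (- u) * h u * g u) \<le> norm (B * M * exp (- u))"
      by simp
  qed
  \<comment> \<open>The function \<open>exp (- u) h u\<close> of \<open>y = exp (- u)\<close>; the extra factor \<open>y\<close> makes it continuous at \<open>y = 0\<close>.\<close>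
  define \<phi> where "\<phi> = (\<lambda>y. if y \<le> 0 then 0 else y * h (- ln y))"
  have cont_\<phi>: "continuous_on {0..1} \<phi>"
    unfolding continuous_on_eq_continuous_within
  proof
    fix y :: real assume y: "y \<in> {0..1}"
    show "continuous (at y within {0..1}) \<phi>"
    proof (cases "y = 0")
      case True
      have "(\<phi> \<longlongrightarrow> 0) (at 0 within {0..1})"
      proof (rule Lim_null_comparison)
        show "\<forall>\<^sub>F y in at 0 within {0..1}. norm (\<phi> y) \<le> B * y"
          unfolding eventually_at_filter
          using bound by (intro always_eventually) (auto simp: \<phi>_def abs_mult mult.commute[of B])
        show "((\<lambda>y. B * y) \<longlongrightarrow> 0) (at 0 within {0..1})"
          by (rule tendsto_eq_intros refl | simp)+
      qed
      then show ?thesis using True by (simp add: continuous_within \<phi>_def)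
    next
      case False
      then have "y > 0" using y by simp
      have "isCont (\<lambda>y. h (- ln y)) y"
        using \<open>y > 0\<close> h
        by (intro isCont_o2[where f = "\<lambda>y. - ln y" and g = h])
           (auto simp: continuous_on_eq_continuous_at intro!: continuous_intros)
      then have "isCont (\<lambda>y. y * h (- ln y)) y"
        by (intro continuous_intros)
      moreover have "\<forall>\<^sub>F x in nhds y. \<phi> x = x * h (- ln x)"
        using eventually_nhds_in_open[of "{0<..}" y] \<open>y > 0\<close>
        by (auto elim!: eventually_mono simp: \<phi>_def)
      ultimately have "isCont \<phi> y" using isCont_cong[of \<phi> "\<lambda>y. y * h (- ln y)" y] by simp
      then show ?thesis by (rule continuous_at_imp_continuous_at_within)
    qed
  qed
  have \<phi>_exp: "\<phi> (exp (- u)) = exp (- u) * h u" for u by (simp add: \<phi>_def)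
  \<comment> \<open>The inner product of \<open>\<phi>\<close> with itself with respect to \<open>du\<close>.\<close>
  define J where "J = (LINT u:{0<..}|lborel. exp (- u) * h u * (exp (- u) * h u))"
  have int_J: "set_integrable lborel {0<..} (\<lambda>u. exp (- u) * h u * (exp (- u) * h u))"
  proof (rule int_bound)
    fix u :: real assume "u > 0"
    then show "\<bar>exp (- u) * h u\<bar> \<le> B"
      using bound[of u] mult_right_mono[of "exp (- u)" 1 "\<bar>h u\<bar>"] by (simp add: abs_mult)
  qed measurable
  have J_bound: "\<bar>J\<bar> \<le> e * B" if e: "e > 0" for e
  proof -
    obtain p where p: "real_polynomial_function p" "\<And>y. y \<in> {0..1} \<Longrightarrow> \<bar>\<phi> y - p y\<bar> < e"
      using Stone_Weierstrass_real_polynomial_function[OF _ cont_\<phi> e] by auto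
    then obtain a N where p_eq: "p = (\<lambda>y. \<Sum>i\<le>N. a i * y ^ i)"
      by (auto simp: real_polynomial_function_iff_sum)
    define q where "q = (\<lambda>u. p (exp (- u)))"
    have int_pow: "set_integrable lborel {0<..} (\<lambda>u. exp (- (real (Suc i) * u)) * h u)" for i
    proof -
      have "set_integrable lborel {0<..} (\<lambda>u. exp (- u) * h u * exp (- (real i * u)))"
        by (rule int_bound[where M = 1]) auto
      then show ?thesis
        by (simp add: algebra_simps flip: exp_add)
    qed
    have q_sum: "exp (- u) * h u * q u = (\<Sum>i\<le>N. a i * (exp (- (real (Suc i) * u)) * h u))" for u
      unfolding q_def p_eq sum_distrib_left
      by (intro sum.cong refl) (simp add: algebra_simps flip: exp_add exp_of_nat_mult)
    have int_q: "set_integrable lborel {0<..} (\<lambda>u. exp (- u) * h u * q u)"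
      using set_integrable_mult_right[OF int_pow]
      unfolding q_sum set_integrable_def scaleR_sum_right by (intro Bochner_Integration.integrable_sum) auto
    have "(LINT u:{0<..}|lborel. exp (- u) * h u * q u) = 0"
    proof -
      have "(LINT u:{0<..}|lborel. a i * (exp (- (real (Suc i) * u)) * h u)) = 0" for i
        using zero[of i] by (subst set_integral_mult_right) simp
      then show ?thesis
        using set_integrable_mult_right[OF int_pow]
        unfolding q_sum set_integrable_def set_lebesgue_integral_def scaleR_sum_right
        by (subst Bochner_Integration.integral_sum) (auto simp del: of_nat_Suc real_scaleR_def)
    qed
    then have "J = (LINT u:{0<..}|lborel. exp (- u) * h u * (exp (- u) * h u) - exp (- u) * h u * q u)"
      unfolding J_def by (subst set_integral_diff(2)[OF int_J int_q]) simp
    also have "\<bar>\<dots>\<bar> \<le> (LINT u:{0<..}|lborel. e * B * exp (- u))"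
    proof -
      have "\<bar>exp (- u) * h u * (exp (- u) * h u) - exp (- u) * h u * q u\<bar> \<le> e * B * exp (- u)"
        if "u > 0" for u
      proof -
        have "\<bar>exp (- u) * h u - q u\<bar> \<le> e"
          using p(2)[of "exp (- u)"] that unfolding \<phi>_exp q_def by simp
        then have "\<bar>h u\<bar> * \<bar>exp (- u) * h u - q u\<bar> \<le> B * e"
          using bound[of u] that B by (intro mult_mono) auto
        then have "exp (- u) * (\<bar>h u\<bar> * \<bar>exp (- u) * h u - q u\<bar>) \<le> exp (- u) * (B * e)"
          by (intro mult_left_mono) auto
        moreover have "\<bar>exp (- u) * h u * (exp (- u) * h u) - exp (- u) * h u * q u\<bar>
            = exp (- u) * (\<bar>h u\<bar> * \<bar>exp (- u) * h u - q u\<bar>)"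
          by (simp add: abs_mult flip: right_diff_distrib)
        ultimately show ?thesis by (simp add: mult_ac)
      qed
      then show ?thesis
        using Bochner_Integration.integral_norm_bound_integral[OF set_integral_diff(1)[OF int_J int_q, unfolded set_integrable_def]
            int_exp[of "e * B", unfolded set_integrable_def]]
        unfolding set_lebesgue_integral_def by (auto simp: indicator_def)
    qed
    also have "\<dots> = e * B"
    proof -
      have "(LINT u:{0<..}|lborel. complex_of_real (exp (- u))) = 1"
        using integral_power_times_exp(2)[of 1 0] by (simp flip: exp_of_real)
      then have "complex_of_real (LINT u:{0<..}|lborel. exp (- u)) = of_real 1"
        by (subst set_integral_complex_of_real[symmetric]) simp
      then have "(LINT u:{0<..}|lborel. exp (- u)) = (1::real)"
        unfolding of_real_eq_iff .
      then show ?thesis by simp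
    qed
    finally show ?thesis .
  qed
  have "\<bar>J\<bar> \<le> 0"
  proof (rule field_le_epsilon)
    fix \<epsilon> :: real assume "\<epsilon> > 0"
    then have "\<bar>J\<bar> \<le> \<epsilon> / (B + 1) * B"
      using B by (intro J_bound) auto
    also have "\<dots> \<le> \<epsilon>" using B \<open>\<epsilon> > 0\<close> by (simp add: field_simps)
    finally show "\<bar>J\<bar> \<le> 0 + \<epsilon>" by simp
  qed
  then have "J = 0" by simp
  show ?thesis
  proof (rule continuous_eq_0_of_weighted_square_integral[OF h, of "\<lambda>u. exp (- u) * exp (- u)"])
    show "set_integrable lborel {0<..} (\<lambda>u. exp (- u) * exp (- u) * (h u)\<^sup>2)"
      using int_J by (simp add: power2_eq_square mult_ac)
    show "(LINT u:{0<..}|lborel. exp (- u) * exp (- u) * (h u)\<^sup>2) = 0"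
      using \<open>J = 0\<close> by (simp add: J_def power2_eq_square mult_ac)
  qed (use u in auto)
qed


text \<open>
  The factor \<open>exp (- c u)\<close> makes the function bounded and shifts its Laplace transform.
\<close>

lemma laplace_eq_0_imp_eq_0:
  assumes f: "continuous_on UNIV f" and bound: "\<And>u. u \<ge> 0 \<Longrightarrow> norm (f u) \<le> B * exp (c * u)"
    and zero: "\<And>n. laplace f (c + real (Suc n)) = 0"
    and u: "u \<ge> 0"
  shows "f u = 0"
proof -
  define g where "g = (\<lambda>u. of_real (exp (- (c * u))) * f u)"
  have g: "continuous_on UNIV g"
    unfolding g_def by (intro continuous_intros f)
  have g_bound: "norm (g u) \<le> B" if "u \<ge> 0" for u
    using mult_left_mono[OF bound[OF that], of "exp (- (c * u))"]
    by (simp add: g_def norm_mult norm_divide exp_minus field_simps)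
  have g_eq: "of_real (exp (- (real (Suc n) * u))) * g u
      = of_real (exp (- ((c + real (Suc n)) * u))) * f u" for n u
    by (simp add: g_def algebra_simps flip: exp_add of_real_mult)
  have int: "integrable lborel (\<lambda>u. indicator {0<..} u *\<^sub>R (of_real (exp (- (real (Suc n) * u))) * g u))" for n
    using set_integrable_laplace[OF f, of B c "c + real (Suc n)"] bound
    unfolding g_eq set_integrable_def by simp
  have int0: "(LINT u|lborel. indicator {0<..} u *\<^sub>R (of_real (exp (- (real (Suc n) * u))) * g u)) = 0" for n
    using zero[of n] unfolding g_eq laplace_def set_lebesgue_integral_def .
  have "Re (g u) = 0"
  proof (rule laplace_zero_imp_zero_real[OF _ _ _ u])
    show "\<bar>Re (g u)\<bar> \<le> B" if "u \<ge> 0" for u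
      using g_bound[OF that] abs_Re_le_cmod order_trans by blast
    show "(LINT u:{0<..}|lborel. exp (- (real (Suc n) * u)) * Re (g u)) = 0" for n
      using integral_Re[OF int[of n]] unfolding int0 set_lebesgue_integral_def by simp
  qed (intro continuous_intros g)
  moreover have "Im (g u) = 0"
  proof (rule laplace_zero_imp_zero_real[OF _ _ _ u])
    show "\<bar>Im (g u)\<bar> \<le> B" if "u \<ge> 0" for u
      using g_bound[OF that] abs_Im_le_cmod order_trans by blast
    show "(LINT u:{0<..}|lborel. exp (- (real (Suc n) * u)) * Im (g u)) = 0" for n
      using integral_Im[OF int[of n]] unfolding int0 set_lebesgue_integral_def by simp
  qed (intro continuous_intros g)
  ultimately have "g u = 0" by (rule complex_eqI[of _ 0, simplified])
  then show ?thesis by (simp add: g_def)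
qed

section \<open>Characteristic functions of finite measures\<close>

context finite_borel_measure
begin

lemma space_UNIV: "space M = UNIV"
  using sets_eq_imp_space_eq[OF M_is_borel] by simp

lemma integrable_bounded:
  fixes f :: "real \<Rightarrow> complex"
  assumes "f \<in> borel_measurable borel" "\<And>x. norm (f x) \<le> B"
  shows "integrable M f"
  using assms by (intro integrable_const_bound[of _ B]) (auto simp: measurable_cong_sets[OF M_is_borel refl])

lemma integrable_iexp_mult: "integrable M (\<lambda>x. iexp (t * x))"
  by (rule integrable_bounded[where B = 1]) (auto simp: norm_exp_i_times)

lemma norm_char_le: "norm (char M t) \<le> measure M UNIV"
proof -
  have "norm (char M t) \<le> (\<integral>x. norm (iexp (t * x)) \<partial>M)"
    unfolding char_def by (rule integral_norm_bound)
  then show ?thesis by (simp add: space_UNIV norm_exp_i_times)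
qed

lemma continuous_on_char: "continuous_on UNIV (char M)"
  unfolding continuous_on_eq_continuous_at[OF open_UNIV]
proof
  fix t :: real
  show "isCont (char M) t"
    unfolding continuous_at_sequentially
  proof safe
    fix X assume X: "X \<longlonglongrightarrow> t"
    show "(char M \<circ> X) \<longlonglongrightarrow> char M t"
      unfolding comp_def char_def
    proof (rule integral_dominated_convergence[where w = "\<lambda>_. 1"])
      show "AE x in M. (\<lambda>n. iexp (X n * x)) \<longlonglongrightarrow> iexp (t * x)"
        using X by (intro AE_I2) (auto intro!: tendsto_intros)
    qed (auto simp: measurable_cong_sets[OF M_is_borel refl] norm_exp_i_times)
  qed
qed

lemma char_uminus: "char M (- t) = cnj (char M t)"
  using Bochner_Integration.integral_cnj[of M "\<lambda>x. iexp (t * x)"] by (simp add: char_def exp_cnj del: integral_cnj)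

text \<open>
  Fubini's theorem: the inner integral is the Laplace transform of a single exponential.
\<close>

lemma laplace_char:
  assumes s: "s > 0"
  shows "laplace (char M) s = (CLINT x|M. 1 / (of_real s - \<i> * of_real x))"
proof -
  note [measurable_cong] = M_is_borel
  interpret pair_sigma_finite lborel M ..
  define f where "f = (\<lambda>u x. indicator {0<..} u *\<^sub>R (of_real (exp (- (s * u))) * iexp (u * x)))"
  have [measurable]: "case_prod f \<in> borel_measurable (lborel \<Otimes>\<^sub>M M)"
    unfolding f_def by measurable
  have int: "integrable (lborel \<Otimes>\<^sub>M M) (case_prod f)"
  proof (rule Fubini_integrable)
    have "integrable lborel (\<lambda>u. measure M UNIV * (indicator {0<..} u *\<^sub>R exp (- (s * u))))"
      using set_integrable_power_times_exp[OF s, of 0]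
      by (intro integrable_mult_right) (simp add: set_integrable_def)
    also have "(\<lambda>u. measure M UNIV * (indicator {0<..} u *\<^sub>R exp (- (s * u))))
        = (\<lambda>u. LINT x|M. norm (case_prod f (u, x)))"
      by (simp add: f_def norm_mult norm_exp_i_times space_UNIV mult_ac)
    finally show "integrable lborel (\<lambda>u. LINT x|M. norm (case_prod f (u, x)))" .
    show "AE u in lborel. integrable M (\<lambda>x. case_prod f (u, x))"
      unfolding f_def by (intro AE_I2) (simp only: case_prod_conv integrable_scaleR_right integrable_mult_right integrable_iexp_mult)
  qed measurable
  have kernel: "(LINT u|lborel. f u x) = 1 / (of_real s - \<i> * of_real x)" for x
  proof -
    have "(LINT u:{0<..}|lborel. of_real u ^ 0 * exp (- ((of_real s - \<i> * of_real x) * of_real u)))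
        = fact 0 / (of_real s - \<i> * of_real x) ^ Suc 0"
      using s by (intro integral_power_times_exp) simp
    then show ?thesis
      unfolding f_def set_lebesgue_integral_def
      by (simp add: algebra_simps exp_add exp_diff exp_minus divide_inverse flip: exp_of_real)
  qed
  have "laplace (char M) s = (LINT u|lborel. LINT x|M. f u x)"
    unfolding laplace_def set_lebesgue_integral_def f_def char_def by simp
  also have "\<dots> = (LINT x|M. LINT u|lborel. f u x)"
    using Fubini_integral[OF int] by simp
  finally show ?thesis unfolding kernel .
qed

end

section \<open>Reflection formulas for polygamma functions\<close>

lemma non_Ints_reflection:
  fixes w :: complex
  assumes w: "w \<notin> \<int>"
  shows "w \<notin> \<int>\<^sub>\<le>\<^sub>0" "1 - w \<notin> \<int>\<^sub>\<le>\<^sub>0" "sin (of_real pi * w) \<noteq> 0"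
proof -
  show "w \<notin> \<int>\<^sub>\<le>\<^sub>0" using w nonpos_Ints_subset_Ints by blast
  have "1 - w \<notin> \<int>" using w Ints_diff[of 1 "1 - w"] by auto
  then show "1 - w \<notin> \<int>\<^sub>\<le>\<^sub>0" using nonpos_Ints_subset_Ints by blast
  show "sin (of_real pi * w) \<noteq> 0"
    using w by (auto simp: sin_eq_0 mult.commute)
qed

text \<open>
  Differentiating the reflection formula of \<open>rGamma\<close> logarithmically gives that of the digamma function,
  and a further derivative gives this one.
\<close>

lemma Polygamma_1_reflection:
  fixes z :: complex
  assumes z: "z \<notin> \<int>"
  shows "Polygamma 1 z + Polygamma 1 (1 - z) = of_real pi ^ 2 / sin (of_real pi * z) ^ 2"
proof -
  have open_nonint: "open (- \<int> :: complex set)"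
    using closed_Ints by blast
  have digamma: "Digamma w - Digamma (1 - w) = - (of_real pi * cos (of_real pi * w) / sin (of_real pi * w))"
    if w: "w \<notin> \<int>" for w :: complex
  proof -
    have "((\<lambda>w. rGamma w * rGamma (1 - w)) has_field_derivative
        rGamma w * (- (- rGamma (1 - w) * Digamma (1 - w))) + (- rGamma w * Digamma w) * rGamma (1 - w)) (at w)"
      using non_Ints_reflection[OF w] by (auto intro!: derivative_eq_intros)
    moreover have "((\<lambda>w. rGamma w * rGamma (1 - w)) has_field_derivative cos (of_real pi * w)) (at w)"
      unfolding rGamma_reflection_complex by (auto intro!: derivative_eq_intros)
    ultimately have "rGamma w * rGamma (1 - w) * (Digamma w - Digamma (1 - w)) = - cos (of_real pi * w)"
      using DERIV_unique by (fastforce simp: algebra_simps)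
    then show ?thesis
      using non_Ints_reflection[OF w] unfolding rGamma_reflection_complex by (simp add: field_simps)
  qed
  have "((\<lambda>w. Digamma w - Digamma (1 - w)) has_field_derivative Polygamma 1 z + Polygamma 1 (1 - z)) (at z)"
    using non_Ints_reflection[OF z] by (auto intro!: derivative_eq_intros)
  moreover have "((\<lambda>w. Digamma w - Digamma (1 - w)) has_field_derivative
      of_real pi ^ 2 / sin (of_real pi * z) ^ 2) (at z)"
  proof (rule has_field_derivative_transform_within_open[OF _ open_nonint])
    show "((\<lambda>w. - (of_real pi * cos (of_real pi * w) / sin (of_real pi * w))) has_field_derivative
        of_real pi ^ 2 / sin (of_real pi * z) ^ 2) (at z)"
    proof -
      define S C where "S = sin (of_real pi * z)" and "C = cos (of_real pi * z)"
      have "((\<lambda>w. - (of_real pi * cos (of_real pi * w) / sin (of_real pi * w))) has_field_derivative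
          - ((of_real pi * (- S * of_real pi) * S - of_real pi * C * (C * of_real pi)) / (S * S))) (at z)"
        unfolding S_def C_def using non_Ints_reflection[OF z]
        by (intro DERIV_minus DERIV_divide DERIV_cmult DERIV_fun_cos DERIV_fun_sin)
           (auto intro!: derivative_eq_intros)
      moreover have "- ((of_real pi * (- S * of_real pi) * S - of_real pi * C * (C * of_real pi)) / (S * S))
          = of_real pi ^ 2 * (S\<^sup>2 + C\<^sup>2) / S ^ 2"
        unfolding minus_divide_left by (rule arg_cong2[where f = "(/)"]) (simp_all add: power2_eq_square algebra_simps)
      moreover have "S\<^sup>2 + C\<^sup>2 = 1" by (simp add: S_def C_def)
      ultimately show ?thesis by (simp add: S_def)
    qed
  qed (use z digamma in auto)
  ultimately show ?thesis by (rule DERIV_unique)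
qed

lemma Polygamma_2_reflection:
  fixes z :: complex
  assumes z: "z \<notin> \<int>"
  shows "Polygamma 2 z - Polygamma 2 (1 - z)
      = - 2 * of_real pi ^ 3 * cos (of_real pi * z) / sin (of_real pi * z) ^ 3"
proof -
  have open_nonint: "open (- \<int> :: complex set)"
    using closed_Ints by blast
  have "((\<lambda>w. Polygamma 1 w + Polygamma 1 (1 - w)) has_field_derivative
      Polygamma 2 z - Polygamma 2 (1 - z)) (at z)"
    using non_Ints_reflection[OF z] by (auto intro!: derivative_eq_intros simp: numeral_2_eq_2)
  moreover have "((\<lambda>w. Polygamma 1 w + Polygamma 1 (1 - w)) has_field_derivative
      - 2 * of_real pi ^ 3 * cos (of_real pi * z) / sin (of_real pi * z) ^ 3) (at z)"
  proof (rule has_field_derivative_transform_within_open[OF _ open_nonint])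
    define S C where "S = sin (of_real pi * z)" and "C = cos (of_real pi * z)"
    have S: "S \<noteq> 0" using non_Ints_reflection[OF z] by (simp add: S_def)
    have "((\<lambda>w. of_real pi ^ 2 / sin (of_real pi * w) ^ 2) has_field_derivative
        (0 * S ^ 2 - of_real pi ^ 2 * (of_nat 2 * (C * of_real pi * S ^ (2 - 1)))) / (S ^ 2 * S ^ 2)) (at z)"
      unfolding S_def C_def using S[unfolded S_def]
      by (intro DERIV_divide DERIV_const DERIV_power[where n = 2, simplified] DERIV_power)
         (auto intro!: derivative_eq_intros)
    moreover have "(0 * S ^ 2 - of_real pi ^ 2 * (of_nat 2 * (C * of_real pi * S ^ (2 - 1)))) / (S ^ 2 * S ^ 2)
        = - 2 * of_real pi ^ 3 * C / S ^ 3"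
      using S by (simp add: field_simps eval_nat_numeral)
    ultimately show "((\<lambda>w. of_real pi ^ 2 / sin (of_real pi * w) ^ 2) has_field_derivative
        - 2 * of_real pi ^ 3 * cos (of_real pi * z) / sin (of_real pi * z) ^ 3) (at z)"
      unfolding S_def C_def by simp
  qed (use z Polygamma_1_reflection in auto)
  ultimately show ?thesis by (rule DERIV_unique)
qed

section \<open>The Fourier transform of the hyperbolic kernel\<close>

definition hyp_kernel :: "real \<Rightarrow> real" where
  "hyp_kernel x = pi / 2 * x\<^sup>2 * (cosh (pi * x / 2) / (sinh (pi * x / 2))\<^sup>2)"

definition decay_rate :: "nat \<Rightarrow> real" where
  "decay_rate k = pi * (1 / 2 + real k)"

lemma decay_rate_pos: "decay_rate k > 0"
  by (simp add: decay_rate_def add_pos_nonneg)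

lemma kernel_nonneg: "hyp_kernel x \<ge> 0"
  by (simp add: hyp_kernel_def)

lemma kernel_uminus: "hyp_kernel (- x) = hyp_kernel x"
  by (simp add: hyp_kernel_def)

lemma kernel_measurable [measurable]: "hyp_kernel \<in> borel_measurable borel"
proof -
  have [measurable]: "(cosh :: real \<Rightarrow> real) \<in> borel_measurable borel"
    "(sinh :: real \<Rightarrow> real) \<in> borel_measurable borel"
    by (intro borel_measurable_continuous_onI continuous_intros)+
  show ?thesis unfolding hyp_kernel_def by measurable
qed

text \<open>
  With \<open>r = exp (- \<pi> x / 2)\<close> this is \<open>\<Sum>k. (2 k + 1) q\<^sup>k = (1 + q) / (1 - q)\<^sup>2\<close> at \<open>q = r\<^sup>2\<close>.
\<close>

lemma kernel_sums:
  assumes x: "x > 0"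
  shows "(\<lambda>k. 2 * decay_rate k * (x\<^sup>2 * exp (- (decay_rate k * x)))) sums hyp_kernel x"
proof -
  define r where "r = exp (- (pi * x / 2))"
  have r: "0 < r" "r < 1" using x by (simp_all add: r_def)
  then have q: "r\<^sup>2 < 1" "r\<^sup>2 \<noteq> 1" by (simp_all add: power_less_one_iff power2_eq_1_iff)
  have "(\<lambda>k. 2 * (of_nat (Suc k) * (r\<^sup>2) ^ k) - (r\<^sup>2) ^ k) sums (2 * (1 / (1 - r\<^sup>2)\<^sup>2) - 1 / (1 - r\<^sup>2))"
    using q by (intro sums_diff sums_mult geometric_deriv_sums geometric_sums) auto
  from sums_mult[OF this, of "pi * x\<^sup>2 * r"]
  have "(\<lambda>k. pi * x\<^sup>2 * r * (2 * (of_nat (Suc k) * (r\<^sup>2) ^ k) - (r\<^sup>2) ^ k)) sums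
      (pi * x\<^sup>2 * r * (2 * (1 / (1 - r\<^sup>2)\<^sup>2) - 1 / (1 - r\<^sup>2)))" .
  also have "(\<lambda>k. pi * x\<^sup>2 * r * (2 * (of_nat (Suc k) * (r\<^sup>2) ^ k) - (r\<^sup>2) ^ k))
      = (\<lambda>k. 2 * decay_rate k * (x\<^sup>2 * exp (- (decay_rate k * x))))"
  proof
    fix k
    have "exp (- (decay_rate k * x)) = exp (- (pi * x / 2) + of_nat (2 * k) * (- (pi * x / 2)))"
      by (simp add: decay_rate_def algebra_simps)
    also have "\<dots> = r * (r\<^sup>2) ^ k"
      unfolding exp_add exp_of_nat_mult by (simp add: r_def flip: power_mult)
    finally show "pi * x\<^sup>2 * r * (2 * (of_nat (Suc k) * (r\<^sup>2) ^ k) - (r\<^sup>2) ^ k)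
        = 2 * decay_rate k * (x\<^sup>2 * exp (- (decay_rate k * x)))"
      by (simp add: decay_rate_def algebra_simps)
  qed
  also have "pi * x\<^sup>2 * r * (2 * (1 / (1 - r\<^sup>2)\<^sup>2) - 1 / (1 - r\<^sup>2)) = hyp_kernel x"
  proof -
    have hyp: "cosh (pi * x / 2) = (1 + r\<^sup>2) / (2 * r)" "sinh (pi * x / 2) = (1 - r\<^sup>2) / (2 * r)"
      using r by (simp_all add: cosh_field_def sinh_field_def r_def exp_minus field_simps power2_eq_square)
    define d where "d = 1 - r\<^sup>2"
    have d: "d \<noteq> 0" "r\<^sup>2 = 1 - d" using q by (simp_all add: d_def)
    show ?thesis
      unfolding hyp_kernel_def hyp using r d(1)
      unfolding d(2) by (simp add: field_simps power2_eq_square)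
  qed
  finally show ?thesis .
qed

text \<open>
  These are the integrals over the half-line of the summands of the exponential series of the kernel,
  so this bound allows integrating that series term by term.
\<close>

lemma summable_inverse_rate_squared: "summable (\<lambda>k. 4 / (decay_rate k)\<^sup>2)"
proof -
  have "summable (\<lambda>k. 4 / pi\<^sup>2 * inverse ((1 / 2 + real k) ^ 2))"
    by (intro summable_mult Polygamma_converges') auto
  moreover have "4 / pi\<^sup>2 * inverse ((1 / 2 + real k) ^ 2) = 4 / (decay_rate k)\<^sup>2" for k
    unfolding decay_rate_def power_mult_distrib divide_inverse by simp
  ultimately show ?thesis by (simp only:)
qed

lemma kernel_half_line_transform:
  shows "set_integrable lborel {0<..} (\<lambda>x. of_real (hyp_kernel x) * iexp (t * x))"
    and "(\<lambda>k. 4 * of_real (decay_rate k) / (of_real (decay_rate k) - \<i> * of_real t) ^ 3) sums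
      (LINT x:{0<..}|lborel. of_real (hyp_kernel x) * iexp (t * x))"
proof -
  define f where "f = (\<lambda>k x. indicator {0<..} x *\<^sub>R (2 * of_real (decay_rate k) *
    (of_real x ^ 2 * exp (- ((of_real (decay_rate k) - \<i> * of_real t) * of_real x)))))"
  have re: "Re (of_real (decay_rate k) - \<i> * of_real t) > 0" for k
    using decay_rate_pos by simp
  have f_int: "integrable lborel (f k)" for k
    using set_integrable_mult_right[OF integral_power_times_exp(1)[OF re]]
    unfolding f_def set_integrable_def by blast
  have f_value: "(LINT x|lborel. f k x) = 4 * of_real (decay_rate k) / (of_real (decay_rate k) - \<i> * of_real t) ^ 3" for k
  proof -
    have "(LINT x|lborel. f k x) = 2 * of_real (decay_rate k) *
        (LINT x:{0<..}|lborel. of_real x ^ 2 * exp (- ((of_real (decay_rate k) - \<i> * of_real t) * of_real x)))"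
      unfolding f_def set_lebesgue_integral_def[symmetric] by (rule set_integral_mult_right)
    then show ?thesis
      unfolding integral_power_times_exp(2)[OF re] by (simp add: eval_nat_numeral)
  qed
  have f_norm: "norm (f k x) = indicator {0<..} x *\<^sub>R (2 * decay_rate k * (x\<^sup>2 * exp (- (decay_rate k * x))))" for k x
    using decay_rate_pos[of k] by (auto simp: f_def norm_mult norm_power indicator_def)
  have f_norm_value: "(LINT x|lborel. norm (f k x)) = 4 / (decay_rate k)\<^sup>2" for k
  proof -
    have "(LINT x|lborel. norm (f k x)) = 2 * decay_rate k * (LINT x:{0<..}|lborel. x ^ 2 * exp (- (decay_rate k * x)))"
      unfolding f_norm set_lebesgue_integral_def[symmetric] by (rule set_integral_mult_right)
    then show ?thesis
      using decay_rate_pos[of k] unfolding integral_real_power_times_exp[OF decay_rate_pos]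
      by (simp add: eval_nat_numeral)
  qed
  have f_sums: "(\<lambda>k. f k x) sums (indicator {0<..} x *\<^sub>R (of_real (hyp_kernel x) * iexp (t * x)))" for x
  proof (cases "x > 0")
    case True
    have "(\<lambda>k. of_real (2 * decay_rate k * (x\<^sup>2 * exp (- (decay_rate k * x)))) * iexp (t * x)) sums
        (of_real (hyp_kernel x) * iexp (t * x))"
      by (intro sums_mult2 sums_of_real kernel_sums True)
    moreover have "of_real (2 * decay_rate k * (x\<^sup>2 * exp (- (decay_rate k * x)))) * iexp (t * x) = f k x" for k
      using True by (simp add: f_def exp_of_real[symmetric] algebra_simps flip: exp_add)
    ultimately show ?thesis using True by simp
  qed (simp add: f_def)
  have f_suminf: "(\<Sum>k. f k x) = indicator {0<..} x *\<^sub>R (of_real (hyp_kernel x) * iexp (t * x))" for x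
    using f_sums by (rule sums_unique[symmetric])
  have f_summable: "summable (\<lambda>k. norm (f k x))" for x
  proof (cases "x > 0")
    case True
    then show ?thesis using sums_summable[OF kernel_sums[OF True]] by (simp add: f_norm)
  qed (simp add: f_norm)
  note sum_facts = f_int AE_I2[OF f_summable] summable_inverse_rate_squared[folded f_norm_value]
  show "set_integrable lborel {0<..} (\<lambda>x. of_real (hyp_kernel x) * iexp (t * x))"
    unfolding set_integrable_def f_suminf[symmetric] by (rule integrable_suminf[OF sum_facts])
  show "(\<lambda>k. 4 * of_real (decay_rate k) / (of_real (decay_rate k) - \<i> * of_real t) ^ 3) sums
      (LINT x:{0<..}|lborel. of_real (hyp_kernel x) * iexp (t * x))"
    unfolding set_lebesgue_integral_def f_suminf[symmetric] f_value[symmetric]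
    by (rule sums_integral[OF sum_facts])
qed

text \<open>
  The second derivative of \<open>t tanh t\<close>.
\<close>

definition x_tanh_deriv2 :: "real \<Rightarrow> real" where
  "x_tanh_deriv2 t = 2 * (1 - t * tanh t) / (cosh t)\<^sup>2"

text \<open>
  Writing \<open>decay_rate k = \<pi> (z + k) + i t\<close> splits the \<open>k\<close>-th term into multiples of \<open>1 / (z + k)\<^sup>2\<close> and \<open>1 / (z + k)\<^sup>3\<close>.
\<close>

lemma kernel_half_line_transform_Polygamma:
  fixes t :: real
  defines "z \<equiv> 1 / 2 - \<i> * of_real t / of_real pi"
  shows "(LINT x:{0<..}|lborel. of_real (hyp_kernel x) * iexp (t * x))
     = 4 / of_real pi ^ 2 * Polygamma 1 z - 2 * \<i> * of_real t / of_real pi ^ 3 * Polygamma 2 z"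
proof (rule sums_unique2[OF kernel_half_line_transform(2)])
  have z0: "z \<noteq> 0"
  proof
    assume "z = 0"
    then have "Re z = 0" by simp
    then show False by (simp add: z_def)
  qed
  have nz: "z + of_nat k \<noteq> 0" for k
  proof
    assume "z + of_nat k = 0"
    then have "Re (z + of_nat k) = 0" by simp
    then show False by (simp add: z_def)
  qed
  have p1: "(\<lambda>k. inverse ((z + of_nat k) ^ 2)) sums Polygamma 1 z"
    using Polygamma_LIMSEQ[OF z0, of 1] by (simp add: numeral_2_eq_2 del: power_Suc)
  have p2: "(\<lambda>k. inverse ((z + of_nat k) ^ 3)) sums (- Polygamma 2 z / 2)"
    using Polygamma_LIMSEQ[OF z0, of 2] by (simp add: eval_nat_numeral)
  have "(\<lambda>k. 4 / of_real pi ^ 2 * inverse ((z + of_nat k) ^ 2)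
        + 4 * \<i> * of_real t / of_real pi ^ 3 * inverse ((z + of_nat k) ^ 3)) sums
      (4 / of_real pi ^ 2 * Polygamma 1 z
        + 4 * \<i> * of_real t / of_real pi ^ 3 * (- Polygamma 2 z / 2))"
    by (intro sums_add sums_mult p1 p2)
  moreover have "4 / of_real pi ^ 2 * inverse ((z + of_nat k) ^ 2)
        + 4 * \<i> * of_real t / of_real pi ^ 3 * inverse ((z + of_nat k) ^ 3)
      = 4 * of_real (decay_rate k) / (of_real (decay_rate k) - \<i> * of_real t) ^ 3" for k
  proof -
    have 1: "of_real (decay_rate k) - \<i> * of_real t = of_real pi * (z + of_nat k)"
      by (simp add: decay_rate_def z_def algebra_simps)
    then have 2: "of_real (decay_rate k) = of_real pi * (z + of_nat k) + \<i> * of_real t"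
      by (simp add: algebra_simps)
    have alg: "4 / p ^ 2 * inverse (w ^ 2) + 4 * v / p ^ 3 * inverse (w ^ 3) = 4 * (p * w + v) / (p * w) ^ 3"
      if "p \<noteq> 0" "w \<noteq> 0" for p w v :: complex
      using that by (simp add: field_simps eval_nat_numeral)
    show ?thesis
      unfolding 1 unfolding 2 using alg[of "of_real pi" "z + of_nat k" "\<i> * of_real t"] nz[of k]
      by (simp add: mult.assoc)
  qed
  ultimately show "(\<lambda>k. 4 * of_real (decay_rate k) / (of_real (decay_rate k) - \<i> * of_real t) ^ 3) sums
      (4 / of_real pi ^ 2 * Polygamma 1 z - 2 * \<i> * of_real t / of_real pi ^ 3 * Polygamma 2 z)"
    by (simp add: mult.assoc)
qed

text \<open>
  Let \<open>z = 1/2 - i t/\<pi>\<close>. Replacing \<open>t\<close> by \<open>- t\<close> replaces \<open>z\<close> by \<open>1 - z\<close>, so the two halves combine by the reflection formulas, where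
  \<open>sin (\<pi> z) = cosh t\<close> and \<open>cos (\<pi> z) = i sinh t\<close>.
\<close>

lemma kernel_line_transform:
  "(LINT x:{0<..}|lborel. of_real (hyp_kernel x) * iexp (t * x))
    + (LINT x:{0<..}|lborel. of_real (hyp_kernel x) * iexp (- t * x)) = 2 * of_real (x_tanh_deriv2 t)"
proof -
  define z where "z = 1 / 2 - \<i> * of_real t / of_real pi"
  have z: "z \<notin> \<int>"
  proof
    assume "z \<in> \<int>"
    then obtain n where "z = of_int n" by (elim Ints_cases)
    then have "Re z = of_int n" by simp
    then have "2 * n = 1" by (simp add: z_def)
    then show False by presburger
  qed
  have z': "1 - z = 1 / 2 - \<i> * of_real (- t) / of_real pi" by (simp add: z_def)
  have piz: "of_real pi * z = of_real pi / 2 - \<i> * of_real t"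
    by (simp add: z_def algebra_simps)
  have i_times: "cos (\<i> * w) = cosh w" "sin (\<i> * w) = \<i> * sinh w" for w :: complex
    by (simp_all add: cosh_conv_cos sinh_conv_sin)
  have "cosh (complex_of_real t) = of_real (cosh t)" "sinh (complex_of_real t) = of_real (sinh t)"
    by (simp_all add: cosh_field_def sinh_field_def exp_of_real[symmetric])
  then have "cos (\<i> * of_real t) = of_real (cosh t)" "sin (\<i> * of_real t) = \<i> * of_real (sinh t)"
    using i_times[of "of_real t"] by simp_all
  then have sc: "sin (of_real pi * z) = of_real (cosh t)" "cos (of_real pi * z) = \<i> * of_real (sinh t)"
    unfolding piz by (simp_all add: sin_diff cos_diff)
  have "(LINT x:{0<..}|lborel. of_real (hyp_kernel x) * iexp (t * x))
      + (LINT x:{0<..}|lborel. of_real (hyp_kernel x) * iexp (- t * x))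
      = 4 / of_real pi ^ 2 * (Polygamma 1 z + Polygamma 1 (1 - z))
        - 2 * \<i> * of_real t / of_real pi ^ 3 * (Polygamma 2 z - Polygamma 2 (1 - z))"
    unfolding kernel_half_line_transform_Polygamma z_def[symmetric] z'[symmetric]
    by (simp add: algebra_simps add_divide_distrib diff_divide_distrib)
  also have "\<dots> = 2 * of_real (x_tanh_deriv2 t)"
  proof -
    have alg: "4 / p ^ 2 * (p ^ 2 / c ^ 2) - 2 * \<i> * u / p ^ 3 * (- 2 * p ^ 3 * (\<i> * s) / c ^ 3)
        = 2 * (2 * (1 - u * (s / c)) / c ^ 2)" if "p \<noteq> 0" "c \<noteq> 0" for p c u s :: complex
      using that by (simp add: field_simps eval_nat_numeral)
    have "cosh t \<noteq> 0" using cosh_real_pos[of t] by linarith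
    then show ?thesis
      unfolding Polygamma_1_reflection[OF z] Polygamma_2_reflection[OF z] sc x_tanh_deriv2_def tanh_def
      by (subst alg) auto
  qed
  finally show ?thesis .
qed

section \<open>The representing measure\<close>

lemma line_integral_split:
  fixes g :: "real \<Rightarrow> complex"
  assumes [measurable]: "g \<in> borel_measurable borel"
    and pos: "set_integrable lborel {0<..} g" and neg: "set_integrable lborel {0<..} (\<lambda>x. g (- x))"
  shows "integrable lborel g"
    and "(LINT x|lborel. g x) = (LINT x:{0<..}|lborel. g x) + (LINT x:{0<..}|lborel. g (- x))"
proof -
  define p n where "p = (\<lambda>x. indicator {0<..} x *\<^sub>R g x)" and "n = (\<lambda>x. indicator {0<..} x *\<^sub>R g (- x))"
  have p: "integrable lborel p" and n: "integrable lborel n"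
    using pos neg by (simp_all add: set_integrable_def p_def n_def)
  have n': "integrable lborel (\<lambda>x. n (- x))" "(LINT x|lborel. n (- x)) = (LINT x|lborel. n x)"
    using lborel_integrable_real_affine[OF n, of "-1" 0] lborel_integral_real_affine[of "-1" n 0] by simp_all
  have ae: "AE x in lborel. p x + n (- x) = g x"
  proof (rule AE_mp[OF AE_lborel_singleton[of 0]])
    show "AE x in lborel. x \<noteq> 0 \<longrightarrow> p x + n (- x) = g x"
      by (intro AE_I2) (auto simp: p_def n_def indicator_def)
  qed
  have [measurable]: "p \<in> borel_measurable borel" "n \<in> borel_measurable borel"
    using p n by auto
  show "integrable lborel g"
    using ae Bochner_Integration.integrable_add[OF p n'(1)]
    by (subst (asm) integrable_cong_AE[where g = g]) auto
  have "(LINT x|lborel. g x) = (LINT x|lborel. p x + n (- x))"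
    using ae by (intro integral_cong_AE) (auto elim: eventually_mono)
  also have "\<dots> = (LINT x|lborel. p x) + (LINT x|lborel. n x)"
    unfolding n'(2)[symmetric] by (rule Bochner_Integration.integral_add[OF p n'(1)])
  finally show "(LINT x|lborel. g x) = (LINT x:{0<..}|lborel. g x) + (LINT x:{0<..}|lborel. g (- x))"
    unfolding p_def n_def set_lebesgue_integral_def .
qed

lemma kernel_integrable: "integrable lborel hyp_kernel"
proof -
  have "set_integrable lborel {0<..} (\<lambda>x. complex_of_real (hyp_kernel x))"
    using kernel_half_line_transform(1)[of 0] by simp
  then have "integrable lborel (\<lambda>x. complex_of_real (hyp_kernel x))"
    by (intro line_integral_split(1)) (auto simp: kernel_uminus)
  from integrable_Re[OF this] show ?thesis by simp
qed

lemma finite_borel_measure_density: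
  fixes w :: "real \<Rightarrow> real"
  assumes "integrable lborel w" "\<And>x. w x \<ge> 0"
  shows "finite_borel_measure (density lborel (\<lambda>x. ennreal (w x)))"
proof -
  have [measurable]: "w \<in> borel_measurable borel" using assms(1) by auto
  have "emeasure (density lborel (\<lambda>x. ennreal (w x))) UNIV = ennreal (integral\<^sup>L lborel w)"
    using assms by (simp add: emeasure_density nn_integral_eq_integral)
  then show ?thesis
    by (intro finite_borel_measure.intro finite_borel_measure_axioms.intro finite_measureI) auto
qed

definition kernel_measure :: "real measure" where
  "kernel_measure = density lborel (\<lambda>x. ennreal (hyp_kernel x / 2))"

text \<open>
  The measure that represents the given transform.
\<close>

definition spectral_measure :: "real measure" where
  "spectral_measure = density lborel (\<lambda>x. ennreal (hyp_kernel x / 2 / (1 + x\<^sup>2)))"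

lemma one_plus_square_ge_1: "1 \<le> 1 + (x::real)\<^sup>2" "1 + (x::real)\<^sup>2 > 0"
proof -
  show "1 \<le> 1 + x\<^sup>2" by simp
  then show "1 + x\<^sup>2 > 0" by linarith
qed

lemma finite_borel_kernel_measure: "finite_borel_measure kernel_measure"
  unfolding kernel_measure_def
  using kernel_integrable kernel_nonneg by (intro finite_borel_measure_density) auto

lemma finite_borel_spectral_measure: "finite_borel_measure spectral_measure"
  unfolding spectral_measure_def
proof (rule finite_borel_measure_density)
  show "integrable lborel (\<lambda>x. hyp_kernel x / 2 / (1 + x\<^sup>2))"
  proof (rule Bochner_Integration.integrable_bound[OF kernel_integrable])
    have "hyp_kernel x / 2 / (1 + x\<^sup>2) \<le> hyp_kernel x" for x
    proof -
      have "hyp_kernel x * 1 \<le> hyp_kernel x * (2 * (1 + x\<^sup>2))"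
        using kernel_nonneg[of x] one_plus_square_ge_1(1)[of x] by (intro mult_left_mono) auto
      then show ?thesis using one_plus_square_ge_1[of x] by (simp add: field_simps)
    qed
    then show "AE x in lborel. norm (hyp_kernel x / 2 / (1 + x\<^sup>2)) \<le> norm (hyp_kernel x)"
      using kernel_nonneg one_plus_square_ge_1 by (intro AE_I2) (simp add: abs_of_nonneg abs_of_pos)
  qed measurable
  show "hyp_kernel x / 2 / (1 + x\<^sup>2) \<ge> 0" for x
    using kernel_nonneg[of x] one_plus_square_ge_1[of x] by (intro divide_nonneg_pos) auto
qed

lemma integral_kernel_measure:
  fixes f :: "real \<Rightarrow> complex"
  assumes [measurable]: "f \<in> borel_measurable borel"
  shows "(LINT x|kernel_measure. f x) = (LINT x|lborel. of_real (hyp_kernel x) * f x) / 2"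
proof -
  have "(LINT x|kernel_measure. f x) = (LINT x|lborel. (hyp_kernel x / 2) *\<^sub>R f x)"
    unfolding kernel_measure_def using kernel_nonneg by (intro integral_density) auto
  also have "\<dots> = (LINT x|lborel. of_real (hyp_kernel x) * f x / 2)"
    by (simp add: scaleR_conv_of_real)
  finally show ?thesis by simp
qed

lemma integral_spectral_measure:
  fixes f :: "real \<Rightarrow> complex"
  assumes [measurable]: "f \<in> borel_measurable borel"
  shows "(LINT x|spectral_measure. f x) = (LINT x|kernel_measure. f x / of_real (1 + x\<^sup>2))"
proof -
  have nonneg: "hyp_kernel x / 2 / (1 + x\<^sup>2) \<ge> 0" for x
    using kernel_nonneg[of x] one_plus_square_ge_1[of x] by (intro divide_nonneg_pos) auto
  have "(LINT x|spectral_measure. f x) = (LINT x|lborel. (hyp_kernel x / 2 / (1 + x\<^sup>2)) *\<^sub>R f x)"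
    unfolding spectral_measure_def using nonneg by (intro integral_density) auto
  also have "\<dots> = (LINT x|lborel. (hyp_kernel x / 2) *\<^sub>R (f x / of_real (1 + x\<^sup>2)))"
    by (intro Bochner_Integration.integral_cong) (auto simp: scaleR_conv_of_real)
  also have "\<dots> = (LINT x|kernel_measure. f x / of_real (1 + x\<^sup>2))"
    unfolding kernel_measure_def using kernel_nonneg by (intro integral_density[symmetric]) auto
  finally show ?thesis .
qed

lemma char_kernel_measure: "char kernel_measure t = of_real (x_tanh_deriv2 t)"
proof -
  have int: "set_integrable lborel {0<..} (\<lambda>x. of_real (hyp_kernel (- x)) * iexp (t * (- x)))"
    using kernel_half_line_transform(1)[of "- t"] by (simp add: kernel_uminus)
  have "char kernel_measure t = (LINT x|lborel. of_real (hyp_kernel x) * iexp (t * x)) / 2"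
    unfolding char_def by (rule integral_kernel_measure) measurable
  also have "(LINT x|lborel. of_real (hyp_kernel x) * iexp (t * x))
      = (LINT x:{0<..}|lborel. of_real (hyp_kernel x) * iexp (t * x))
        + (LINT x:{0<..}|lborel. of_real (hyp_kernel (- x)) * iexp (t * (- x)))"
    using kernel_half_line_transform(1) int by (intro line_integral_split) measurable
  also have "\<dots> = 2 * of_real (x_tanh_deriv2 t)"
    using kernel_line_transform[of t] by (simp add: kernel_uminus)
  finally show ?thesis by simp
qed

lemma char_spectral_measure:
  "char spectral_measure t = of_real (pi / 2 *
     (LBINT x:{0<..}. cos (t * x) * (x\<^sup>2 / (1 + x\<^sup>2)) * (cosh (pi * x / 2) / (sinh (pi * x / 2))\<^sup>2)))"
proof -
  define g where "g = (\<lambda>t x. complex_of_real (hyp_kernel x) * (iexp (t * x) / of_real (1 + x\<^sup>2)))"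
  have [measurable]: "g t \<in> borel_measurable borel" for t
    unfolding g_def by measurable
  have g_int: "set_integrable lborel {0<..} (g t)" for t
  proof (rule set_integrable_bound[OF kernel_half_line_transform(1)[of t]])
    show "set_borel_measurable lborel {0<..} (g t)"
      unfolding set_borel_measurable_def by measurable
    have "norm (g t x) \<le> norm (complex_of_real (hyp_kernel x) * iexp (t * x))" for x
    proof -
      have "norm (1 + (complex_of_real x)\<^sup>2) = 1 + x\<^sup>2"
        using one_plus_square_ge_1(2)[of x]
        by (metis abs_of_pos norm_of_real of_real_1 of_real_add of_real_power)
      moreover have "hyp_kernel x * 1 \<le> hyp_kernel x * (1 + x\<^sup>2)"
        using kernel_nonneg[of x] one_plus_square_ge_1[of x] by (intro mult_left_mono)
      ultimately show ?thesis
        using one_plus_square_ge_1[of x] kernel_nonneg[of x]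
        by (simp add: g_def norm_mult norm_divide norm_exp_i_times divide_le_eq)
    qed
    then show "AE x in lborel. x \<in> {0<..} \<longrightarrow>
        norm (g t x) \<le> norm (complex_of_real (hyp_kernel x) * iexp (t * x))" by simp
  qed
  have g_uminus: "g t (- x) = g (- t) x" for t x
    by (simp add: g_def kernel_uminus)
  have "char spectral_measure t = (LINT x|kernel_measure. iexp (t * x) / of_real (1 + x\<^sup>2))"
    unfolding char_def by (rule integral_spectral_measure) measurable
  also have "\<dots> = (LINT x|lborel. g t x) / 2"
    unfolding g_def by (rule integral_kernel_measure) measurable
  also have "(LINT x|lborel. g t x) = (LINT x:{0<..}|lborel. g t x) + (LINT x:{0<..}|lborel. g t (- x))"
    using g_int unfolding g_uminus by (subst line_integral_split) (auto simp: g_uminus)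
  also have "\<dots> = (LINT x:{0<..}|lborel. g t x + g t (- x))"
    unfolding g_uminus by (rule set_integral_add(2)[symmetric, OF g_int g_int])
  also have "(\<lambda>x. g t x + g t (- x)) = (\<lambda>x. complex_of_real (pi * (cos (t * x) * (x\<^sup>2 / (1 + x\<^sup>2))
      * (cosh (pi * x / 2) / (sinh (pi * x / 2))\<^sup>2))))"
  proof
    fix x
    have "iexp (t * x) + iexp (- t * x) = 2 * cos (complex_of_real (t * x))"
      by (simp add: cos_exp_eq)
    then have *: "iexp (t * x) + iexp (- t * x) = complex_of_real (2 * cos (t * x))"
      unfolding cos_of_real by simp
    have "g t x + g t (- x) = of_real (hyp_kernel x) * (iexp (t * x) + iexp (- t * x)) / of_real (1 + x\<^sup>2)"
      by (simp add: g_uminus) (simp add: g_def ring_distribs add_divide_distrib)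
    also have "\<dots> = complex_of_real (hyp_kernel x * (2 * cos (t * x)) / (1 + x\<^sup>2))"
      unfolding * by simp
    also have "hyp_kernel x * (2 * cos (t * x)) / (1 + x\<^sup>2)
        = pi * (cos (t * x) * (x\<^sup>2 / (1 + x\<^sup>2)) * (cosh (pi * x / 2) / (sinh (pi * x / 2))\<^sup>2))"
      by (simp add: hyp_kernel_def mult_ac)
    finally show "g t x + g t (- x) = complex_of_real (pi * (cos (t * x) * (x\<^sup>2 / (1 + x\<^sup>2))
      * (cosh (pi * x / 2) / (sinh (pi * x / 2))\<^sup>2)))" .
  qed
  also have "(LINT x:{0<..}|lborel. complex_of_real (pi * (cos (t * x) * (x\<^sup>2 / (1 + x\<^sup>2))
      * (cosh (pi * x / 2) / (sinh (pi * x / 2))\<^sup>2))))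
    = complex_of_real (pi * (LBINT x:{0<..}. cos (t * x) * (x\<^sup>2 / (1 + x\<^sup>2))
      * (cosh (pi * x / 2) / (sinh (pi * x / 2))\<^sup>2)))"
    unfolding set_integral_complex_of_real set_integral_mult_right ..
  finally show ?thesis by simp
qed

section \<open>Representations on the imaginary axis\<close>

text \<open>
  Division of \<open>1 + itx\<close> by \<open>it - x\<close> with remainder \<open>1 - t\<^sup>2\<close>.
\<close>

lemma representation_kernel:
  fixes t x :: real
  assumes "t > 0"
  shows "(1 + \<i> * of_real t * of_real x) / (\<i> * of_real t - of_real x)
    = - (\<i> * of_real t) - \<i> * (1 - of_real t ^ 2) * cnj (1 / (of_real t - \<i> * of_real x))"
proof -
  have nz: "of_real t + \<i> * complex_of_real x \<noteq> 0"
  proof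
    assume "of_real t + \<i> * complex_of_real x = 0"
    then have "Re (of_real t + \<i> * complex_of_real x) = 0" by simp
    then show False using assms by simp
  qed
  have "\<i> * of_real t - of_real x = \<i> * (of_real t + \<i> * complex_of_real x)"
    by (simp add: algebra_simps)
  then show ?thesis
    using nz by (simp add: divide_simps) (simp add: algebra_simps power2_eq_square)
qed

context finite_borel_measure
begin

lemma norm_resolvent_le:
  assumes "t > 0"
  shows "norm (1 / (of_real t - \<i> * complex_of_real x)) \<le> 1 / t"
proof -
  have "t \<le> norm (of_real t - \<i> * complex_of_real x)"
    using complex_Re_le_cmod[of "of_real t - \<i> * complex_of_real x"] by simp
  then show ?thesis using assms by (simp add: norm_divide frac_le)
qed

lemma integrable_resolvent:
  assumes "t > 0"
  shows "integrable M (\<lambda>x. 1 / (of_real t - \<i> * complex_of_real x))"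
  using norm_resolvent_le[OF assms] by (intro integrable_bounded[where B = "1 / t"]) auto

lemma representation_integral:
  assumes t: "t > 0"
  shows "(CLINT x|M. (1 + \<i> * of_real t * of_real x) / (\<i> * of_real t - of_real x))
    = - (\<i> * of_real t) * of_real (measure M UNIV) - \<i> * (1 - of_real t ^ 2) * cnj (laplace (char M) t)"
proof -
  have "integrable M (\<lambda>x. cnj (1 / (of_real t - \<i> * complex_of_real x)))"
    using integrable_resolvent[OF t] by (rule integrable_cnj)
  then show ?thesis
    unfolding representation_kernel[OF t] laplace_char[OF t]
    by (subst Bochner_Integration.integral_diff)
       (auto simp: space_UNIV scaleR_conv_of_real simp del: complex_cnj_divide complex_cnj_diff)
qed

end

lemma laplace_char_diff:
  assumes "finite_borel_measure m" "finite_borel_measure m'" "s > 0"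
  shows "laplace (\<lambda>u. char m u - char m' u) s = laplace (char m) s - laplace (char m') s"
proof -
  interpret m: finite_borel_measure m by fact
  interpret m': finite_borel_measure m' by fact
  have "set_integrable lborel {0<..} (\<lambda>u. of_real (exp (- (s * u))) * char m u)"
    "set_integrable lborel {0<..} (\<lambda>u. of_real (exp (- (s * u))) * char m' u)"
    using \<open>s > 0\<close> m.norm_char_le m'.norm_char_le
    by (auto intro!: set_integrable_laplace[where c = 0] m.continuous_on_char m'.continuous_on_char)
  then show ?thesis
    unfolding laplace_def right_diff_distrib by (rule set_integral_diff)
qed

text \<open>
  At \<open>t = 1\<close> the Laplace transform drops out of the representation, which leaves \<open>a\<close> and the mass as real and
  imaginary part; at \<open>t > 1\<close> its coefficient does not vanish.
\<close>

lemma voiculescu_representation_unique: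
  assumes rep: "voiculescu_representation V a m" and rep': "voiculescu_representation V a' m'"
  shows "a = a'" "measure m UNIV = measure m' UNIV" "char m = char m'"
proof -
  interpret m: finite_borel_measure m
    using rep by (simp add: voiculescu_representation_def)
  interpret m': finite_borel_measure m'
    using rep' by (simp add: voiculescu_representation_def)
  have V: "V (\<i> * of_real t) = of_real a - (\<i> * of_real t) * of_real (measure m UNIV)
      - \<i> * (1 - of_real t ^ 2) * cnj (laplace (char m) t)" if "t > 0" for t
    using rep that m.representation_integral[OF that] by (simp add: voiculescu_representation_def)
  have V': "V (\<i> * of_real t) = of_real a' - (\<i> * of_real t) * of_real (measure m' UNIV)
      - \<i> * (1 - of_real t ^ 2) * cnj (laplace (char m') t)" if "t > 0" for t
    using rep' that m'.representation_integral[OF that] by (simp add: voiculescu_representation_def)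
  have "of_real a - \<i> * of_real (measure m UNIV) = of_real a' - \<i> * of_real (measure m' UNIV)"
    using V[of 1] V'[of 1] by simp
  then show a: "a = a'" and mass: "measure m UNIV = measure m' UNIV"
    by (simp_all add: complex_eq_iff)
  have laplace_eq: "laplace (char m) t = laplace (char m') t" if "t > 1" for t
  proof -
    have "1 - complex_of_real t ^ 2 \<noteq> 0"
    proof
      assume "1 - complex_of_real t ^ 2 = 0"
      then have "complex_of_real (t ^ 2) = of_real 1" by simp
      then have "t ^ 2 = 1" unfolding of_real_eq_iff .
      then show False using that by (simp add: power2_eq_1_iff)
    qed
    then show ?thesis
      using V[of t] V'[of t] that a mass by simp
  qed
  have eq: "char m u = char m' u" if u: "u \<ge> 0" for u
  proof -
    have "char m u - char m' u = 0"
    proof (rule laplace_eq_0_imp_eq_0[OF _ _ _ u])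
      show "continuous_on UNIV (\<lambda>u. char m u - char m' u)"
        by (intro continuous_intros m.continuous_on_char m'.continuous_on_char)
      show "norm (char m u - char m' u) \<le> (measure m UNIV + measure m' UNIV) * exp (1 * u)"
        if "u \<ge> 0" for u
      proof -
        have "norm (char m u - char m' u) \<le> (measure m UNIV + measure m' UNIV) * 1"
          unfolding mult_1_right
          by (rule order_trans[OF norm_triangle_ineq4 add_mono[OF m.norm_char_le m'.norm_char_le]])
        also have "\<dots> \<le> (measure m UNIV + measure m' UNIV) * exp (1 * u)"
          using that by (intro mult_left_mono) auto
        finally show ?thesis .
      qed
      show "laplace (\<lambda>u. char m u - char m' u) (1 + real (Suc n)) = 0" for n
        using laplace_char_diff[OF m.finite_borel_measure_axioms m'.finite_borel_measure_axioms]
          laplace_eq by simp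
    qed
    then show ?thesis by simp
  qed
  show "char m = char m'"
  proof
    fix u
    show "char m u = char m' u"
      using eq[of u] eq[of "- u"] m.char_uminus[of "- u"] m'.char_uminus[of "- u"]
      by (cases "u \<ge> 0") auto
  qed
qed

text \<open>
  The kernel of the representation divided by \<open>1 + x\<^sup>2\<close> is \<open>Im (1 / (1 - ix)) - i cnj (1 / (t - ix))\<close>. The integral of
  \<open>1 / (s - ix)\<close> is the Laplace transform of a real function, so the first summand contributes nothing.
\<close>

lemma spectral_representation_integral:
  assumes t: "t > 0"
  shows "(CLINT x|spectral_measure. (1 + \<i> * of_real t * of_real x) / (\<i> * of_real t - of_real x))
    = - \<i> * laplace (\<lambda>u. of_real (x_tanh_deriv2 u)) t"
proof -
  interpret kernel_measure: finite_borel_measure kernel_measure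
    by (rule finite_borel_kernel_measure)
  define L where "L = laplace (\<lambda>u. of_real (x_tanh_deriv2 u))"
  have L: "(CLINT x|kernel_measure. 1 / (of_real s - \<i> * of_real x)) = L s" if "s > 0" for s
    using kernel_measure.laplace_char[OF that] by (simp add: L_def char_kernel_measure[abs_def])
  have L_real: "cnj (L s) = L s" for s
    unfolding L_def laplace_def set_lebesgue_integral_def
    by (subst Bochner_Integration.integral_cnj[symmetric]) simp
  have split: "(1 + \<i> * of_real t * of_real x) / (\<i> * of_real t - of_real x) / of_real (1 + x\<^sup>2)
      = (1 / (of_real 1 - \<i> * of_real x) - cnj (1 / (of_real 1 - \<i> * of_real x))) / (2 * \<i>)
        - \<i> * cnj (1 / (of_real t - \<i> * of_real x))" for x
  proof -
    define y where "y = complex_of_real x"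
    have nz: "complex_of_real s + \<i> * y \<noteq> 0" if "s > 0" for s
    proof
      assume "complex_of_real s + \<i> * y = 0"
      then have "Re (complex_of_real s + \<i> * y) = 0" by simp
      then show False using that by (simp add: y_def)
    qed
    have nz1: "1 + \<i> * y \<noteq> 0" using nz[of 1] by simp
    have nz2: "1 - \<i> * y \<noteq> 0"
    proof
      assume "1 - \<i> * y = 0"
      then have "Re (1 - \<i> * y) = 0" by simp
      then show False by (simp add: y_def)
    qed
    have fact: "of_real (1 + x\<^sup>2) = (1 - \<i> * y) * (1 + \<i> * y)"
      by (simp add: y_def algebra_simps power2_eq_square)
    have lin: "\<i> * of_real t - y = \<i> * (of_real t + \<i> * y)"
      by (simp add: algebra_simps)
    have cnj_eq: "cnj (1 / (of_real s - \<i> * of_real x)) = 1 / (of_real s + \<i> * y)" for s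
      by (simp add: y_def)
    have "(1 + \<i> * T * y) / (\<i> * w) / (u * v)
        = (1 / u - 1 / v) / (2 * \<i>) - \<i> * (1 / w)"
      if "u = 1 - \<i> * y" "v = 1 + \<i> * y" "w = T + \<i> * y" "u \<noteq> 0" "v \<noteq> 0" "w \<noteq> 0" for T u v w
    proof -
      have "(1 + \<i> * T * y) * 2 = (v - u) * w + 2 * (u * v)"
        unfolding that(1-3) by (simp add: algebra_simps)
      then show ?thesis using that(4-6) by (simp add: divide_simps) (simp add: algebra_simps)
    qed
    from this[OF refl refl refl nz2 nz1 nz[OF t]] show ?thesis
      unfolding fact cnj_eq unfolding y_def[symmetric] lin by simp
  qed
  have "(CLINT x|spectral_measure. (1 + \<i> * of_real t * of_real x) / (\<i> * of_real t - of_real x))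
      = (CLINT x|kernel_measure. (1 + \<i> * of_real t * of_real x) / (\<i> * of_real t - of_real x) / of_real (1 + x\<^sup>2))"
    by (rule integral_spectral_measure) measurable
  also have "\<dots> = (L 1 - cnj (L 1)) / (2 * \<i>) - \<i> * cnj (L t)"
  proof -
    have int: "integrable kernel_measure (\<lambda>x. 1 / (of_real s - \<i> * complex_of_real x))"
      "integrable kernel_measure (\<lambda>x. cnj (1 / (of_real s - \<i> * complex_of_real x)))" if "s > 0" for s
      using kernel_measure.integrable_resolvent[OF that] integrable_cnj by blast+
    have "(CLINT x|kernel_measure. (1 / (of_real 1 - \<i> * of_real x) - cnj (1 / (of_real 1 - \<i> * of_real x))) / (2 * \<i>)
        - \<i> * cnj (1 / (of_real t - \<i> * of_real x)))
      = ((CLINT x|kernel_measure. 1 / (of_real 1 - \<i> * of_real x))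
          - (CLINT x|kernel_measure. cnj (1 / (of_real 1 - \<i> * of_real x)))) / (2 * \<i>)
        - \<i> * (CLINT x|kernel_measure. cnj (1 / (of_real t - \<i> * of_real x)))"
      using int[OF zero_less_one] int[OF t]
      by (simp only: Bochner_Integration.integral_diff integral_divide_zero integral_mult_right_zero
          Bochner_Integration.integrable_diff integrable_divide_zero integrable_mult_right)
    then show ?thesis
      unfolding split Bochner_Integration.integral_cnj using L[of 1] L[OF t] by simp
  qed
  also have "\<dots> = - \<i> * L t" by (simp add: L_real)
  finally show ?thesis by (simp add: L_def)
qed

lemma voiculescu_representation_spectral_measure:
  assumes V: "\<And>t. t > 0 \<Longrightarrow> V (\<i> * of_real t) = - \<i> * laplace (\<lambda>u. of_real (x_tanh_deriv2 u)) t"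
    and V_cnj: "\<And>t. t > 0 \<Longrightarrow> V (- (\<i> * of_real t)) = cnj (V (\<i> * of_real t))"
  shows "voiculescu_representation V 0 spectral_measure"
  unfolding voiculescu_representation_def
proof (intro conjI finite_borel_spectral_measure allI impI)
  define I where "I = (\<lambda>t. CLINT x|spectral_measure.
    (1 + \<i> * of_real t * of_real x) / (\<i> * of_real t - of_real x))"
  have I_cnj: "I (- t) = cnj (I t)" for t
    unfolding I_def Bochner_Integration.integral_cnj[symmetric]
    by (intro Bochner_Integration.integral_cong) simp_all
  fix t :: real assume "t \<noteq> 0"
  have "V (\<i> * of_real t) = I t"
  proof (cases "t > 0")
    case True
    then show ?thesis using V spectral_representation_integral by (simp add: I_def)
  next
    case False
    with \<open>t \<noteq> 0\<close> have "- t > 0" by simp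
    then have "V (\<i> * of_real (- t)) = I (- t)" "V (\<i> * of_real t) = cnj (V (\<i> * of_real (- t)))"
      using V[of "- t"] V_cnj[of "- t"] spectral_representation_integral[of "- t"] by (simp_all add: I_def)
    then show ?thesis using I_cnj[of t] by simp
  qed
  then show "V (\<i> * of_real t) = of_real 0 + (CLINT x|spectral_measure.
      (1 + \<i> * of_real t * of_real x) / (\<i> * of_real t - of_real x))"
    by (simp add: I_def)
qed

section \<open>The transform in terms of the Hurwitz zeta function\<close>

text \<open>
  Two integrations by parts: \<open>exp (- s u) (f' u + s f u)\<close> has derivative \<open>exp (- s u) (f'' u - s\<^sup>2 f u)\<close>.
\<close>

lemma laplace_second_derivative:
  fixes f f' f'' :: "real \<Rightarrow> complex"
  assumes f: "\<And>u. (f has_vector_derivative f' u) (at u)"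
    and f': "\<And>u. (f' has_vector_derivative f'' u) (at u)"
    and f'': "continuous_on UNIV f''"
    and bound: "\<And>u. u \<ge> 0 \<Longrightarrow> norm (f u) \<le> B * exp (c * u)"
    and bound': "\<And>u. u \<ge> 0 \<Longrightarrow> norm (f' u) \<le> B * exp (c * u)"
    and bound'': "\<And>u. u \<ge> 0 \<Longrightarrow> norm (f'' u) \<le> B * exp (c * u)"
    and s: "c < s"
  shows "laplace f'' s = of_real s ^ 2 * laplace f s - of_real s * f 0 - f' 0"
proof -
  have cont: "continuous_on UNIV f" "continuous_on UNIV f'"
    using f f' by (auto intro!: continuous_at_imp_continuous_on has_vector_derivative_continuous)
  define F where "F = (\<lambda>u. of_real (exp (- (s * u))) * (f' u + of_real s * f u))"
  have F_cont: "isCont F u" for u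
    using cont unfolding F_def by (intro continuous_intros) (auto simp: continuous_on_eq_continuous_at)
  have int: "set_integrable lborel {0<..} (\<lambda>u. of_real (exp (- (s * u))) * f u)"
    "set_integrable lborel {0<..} (\<lambda>u. of_real (exp (- (s * u))) * f'' u)"
    using bound bound'' s cont f'' by (auto intro!: set_integrable_laplace[where B = B and c = c])
  have "(LINT u:{0<..}|lborel. of_real (exp (- (s * u))) * f'' u - of_real s ^ 2 * (of_real (exp (- (s * u))) * f u))
      = 0 - F 0"
  proof (rule half_line_FTC[where F = F])
    show "(F has_vector_derivative
        of_real (exp (- (s * u))) * f'' u - of_real s ^ 2 * (of_real (exp (- (s * u))) * f u)) (at u)" for u
    proof -
      have e: "((\<lambda>u. complex_of_real (exp (- (s * u)))) has_vector_derivative of_real (- s * exp (- (s * u)))) (at u)"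
        by (intro has_vector_derivative_of_real) (auto intro!: derivative_eq_intros)
      have "(F has_vector_derivative (of_real (exp (- (s * u))) * (f'' u + of_real s * f' u)
          + of_real (- s * exp (- (s * u))) * (f' u + of_real s * f u))) (at u)"
        unfolding F_def
        by (intro has_vector_derivative_mult e has_vector_derivative_add f' has_vector_derivative_mult_right f)
      then show ?thesis by (simp add: algebra_simps power2_eq_square)
    qed
    show "continuous_on {0<..} (\<lambda>u. of_real (exp (- (s * u))) * f'' u - of_real s ^ 2 * (of_real (exp (- (s * u))) * f u))"
      using cont f'' by (intro continuous_intros) (auto intro: continuous_on_subset)
    show "set_integrable lborel {0<..} (\<lambda>u. of_real (exp (- (s * u))) * f'' u - of_real s ^ 2 * (of_real (exp (- (s * u))) * f u))"
      by (intro set_integral_diff set_integrable_mult_right int)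
    show "(F \<longlongrightarrow> F 0) (at_right 0)"
      using F_cont[of 0] by (simp add: isCont_def filterlim_at_split)
    show "(F \<longlongrightarrow> 0) at_top"
    proof (rule Lim_null_comparison)
      have "norm (F u) \<le> B * (1 + \<bar>s\<bar>) * (u ^ 0 * exp (- ((s - c) * u)))" if u: "u \<ge> 0" for u
      proof -
        have "norm (f' u + of_real s * f u) \<le> B * exp (c * u) + \<bar>s\<bar> * (B * exp (c * u))"
          using bound[OF u] bound'[OF u]
          by (intro order_trans[OF norm_triangle_ineq] add_mono) (auto simp: norm_mult intro!: mult_left_mono)
        then have "norm (F u) \<le> exp (- (s * u)) * (B * exp (c * u) + \<bar>s\<bar> * (B * exp (c * u)))"
          unfolding F_def by (simp add: norm_mult)
        also have "\<dots> = B * (1 + \<bar>s\<bar>) * (exp (- (s * u)) * exp (c * u))" by (simp add: algebra_simps)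
        also have "exp (- (s * u)) * exp (c * u) = exp (- ((s - c) * u))"
          by (simp add: algebra_simps flip: exp_add)
        finally show ?thesis by simp
      qed
      then show "\<forall>\<^sub>F u in at_top. norm (F u) \<le> B * (1 + \<bar>s\<bar>) * (u ^ 0 * exp (- ((s - c) * u)))"
        by (rule eventually_mono[OF eventually_ge_at_top[of 0]])
      show "((\<lambda>u. B * (1 + \<bar>s\<bar>) * (u ^ 0 * exp (- ((s - c) * u)))) \<longlongrightarrow> 0) at_top"
        using s by (intro tendsto_mult_right_zero tendsto_power_times_exp_at_top) simp
    qed
  qed
  also have "(LINT u:{0<..}|lborel. of_real (exp (- (s * u))) * f'' u - of_real s ^ 2 * (of_real (exp (- (s * u))) * f u))
      = laplace f'' s - of_real s ^ 2 * laplace f s"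
    unfolding laplace_def by (subst set_integral_diff) (auto intro!: set_integrable_mult_right int)
  finally show ?thesis by (simp add: F_def algebra_simps)
qed

lemma has_real_derivative_x_tanh:
  "((\<lambda>u. u * tanh u) has_real_derivative tanh u + u * (1 - (tanh u)\<^sup>2)) (at u)"
  by (auto intro!: derivative_eq_intros)

lemma sech_squared: "1 - (tanh u)\<^sup>2 = 1 / (cosh (u::real))\<^sup>2"
proof -
  have "cosh u \<noteq> 0" using cosh_real_pos[of u] by linarith
  moreover have "(sinh u)\<^sup>2 = (cosh u)\<^sup>2 - 1"
    using hyperbolic_pythagoras[of u] by simp
  ultimately show ?thesis
    by (simp add: tanh_def power_divide diff_divide_distrib)
qed

lemma has_real_derivative_x_tanh_deriv:
  "((\<lambda>u. tanh u + u * (1 - (tanh u)\<^sup>2)) has_real_derivative x_tanh_deriv2 u) (at u)"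
proof -
  have "((\<lambda>u. tanh u + u * (1 - (tanh u)\<^sup>2)) has_real_derivative
      2 * (1 - u * tanh u) * (1 - (tanh u)\<^sup>2)) (at u)"
    by (auto intro!: derivative_eq_intros)
       (simp add: algebra_simps power2_eq_square)
  then show ?thesis by (simp add: x_tanh_deriv2_def sech_squared)
qed

lemma abs_tanh_le_1: "\<bar>tanh u\<bar> \<le> 1" for u :: real
  using tanh_real_bounds[of u] by auto

lemma sech_squared_bounds: "0 \<le> 1 - (tanh u)\<^sup>2" "1 - (tanh u)\<^sup>2 \<le> 1" for u :: real
  using abs_tanh_le_1[of u] by (auto simp: abs_square_le_1)

lemma x_tanh_deriv2_bound: "\<bar>x_tanh_deriv2 u\<bar> \<le> 2 * (1 + \<bar>u\<bar>)"
proof -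
  have "\<bar>u * tanh u\<bar> \<le> \<bar>u\<bar> * 1"
    unfolding abs_mult using abs_tanh_le_1 by (intro mult_left_mono) auto
  then have "\<bar>1 - u * tanh u\<bar> \<le> 1 + \<bar>u\<bar>" by linarith
  then have "\<bar>1 - u * tanh u\<bar> * (1 - (tanh u)\<^sup>2) \<le> (1 + \<bar>u\<bar>) * 1"
    using sech_squared_bounds[of u] by (intro mult_mono) auto
  moreover have "x_tanh_deriv2 u = 2 * ((1 - u * tanh u) * (1 - (tanh u)\<^sup>2))"
    by (simp add: x_tanh_deriv2_def sech_squared)
  then have "\<bar>x_tanh_deriv2 u\<bar> = 2 * (\<bar>1 - u * tanh u\<bar> * (1 - (tanh u)\<^sup>2))"
    using sech_squared_bounds[of u] by (simp only: abs_mult abs_of_nonneg abs_numeral)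
  ultimately show ?thesis by linarith
qed

lemma continuous_on_x_tanh_deriv2: "continuous_on UNIV x_tanh_deriv2"
  unfolding x_tanh_deriv2_def[abs_def]
  by (intro continuous_intros) auto

text \<open>
  Both boundary terms vanish. Linear growth is dominated by \<open>exp (c u)\<close> for every \<open>c > 0\<close>, and \<open>c = s / 2\<close> will do.
\<close>

lemma laplace_x_tanh_deriv2_eq:
  assumes s: "s > 0"
  shows "laplace (\<lambda>u. of_real (x_tanh_deriv2 u)) s = of_real s ^ 2 * laplace (\<lambda>u. of_real (u * tanh u)) s"
proof -
  define c where "c = s / 2"
  have c: "c > 0" "c < s" using s by (simp_all add: c_def)
  define B where "B = 2 * (1 + 1 / c)"
  have lin: "2 * (1 + \<bar>u\<bar>) \<le> B * exp (c * u)" if "u \<ge> 0" for u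
  proof -
    have "1 + c * u \<le> exp (c * u)" by (rule exp_ge_add_one_self)
    moreover have "c * 1 \<le> c * exp (c * u)" using c that by (intro mult_left_mono) auto
    moreover have "c * (exp (c * u) + exp (c * u) / c) = c * exp (c * u) + exp (c * u)"
      using c by (simp add: ring_distribs)
    ultimately have "c * (1 + u) \<le> c * (exp (c * u) + exp (c * u) / c)"
      unfolding distrib_left[of c 1 u] by linarith
    then have "1 + u \<le> exp (c * u) + exp (c * u) / c"
      using c by (simp only: mult_le_cancel_left_pos)
    then show ?thesis using that by (simp add: B_def algebra_simps)
  qed
  have G: "\<bar>u * tanh u\<bar> \<le> 2 * (1 + \<bar>u\<bar>)" for u :: real
    using mult_left_mono[OF abs_tanh_le_1[of u], of "\<bar>u\<bar>"] by (simp add: abs_mult)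
  have G': "\<bar>tanh u + u * (1 - (tanh u)\<^sup>2)\<bar> \<le> 2 * (1 + \<bar>u\<bar>)" for u :: real
  proof -
    have "\<bar>u * (1 - (tanh u)\<^sup>2)\<bar> \<le> \<bar>u\<bar> * 1"
      unfolding abs_mult using sech_squared_bounds[of u] by (intro mult_left_mono) auto
    moreover have "\<bar>a + b\<bar> \<le> 2 * (1 + \<bar>u\<bar>)" if "\<bar>a\<bar> \<le> 1" "\<bar>b\<bar> \<le> \<bar>u\<bar> * 1" for a b :: real
    proof (rule order_trans[OF abs_triangle_ineq])
      show "\<bar>a\<bar> + \<bar>b\<bar> \<le> 2 * (1 + \<bar>u\<bar>)" using that abs_ge_zero[of u] by simp
    qed
    ultimately show ?thesis using abs_tanh_le_1[of u] by blast
  qed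
  have "laplace (\<lambda>u. of_real (x_tanh_deriv2 u)) s
      = of_real s ^ 2 * laplace (\<lambda>u. of_real (u * tanh u)) s - of_real s * of_real (0 * tanh 0)
        - of_real (tanh 0 + 0 * (1 - (tanh 0)\<^sup>2))"
  proof (rule laplace_second_derivative[where c = c and B = B])
    show "((\<lambda>u. complex_of_real (u * tanh u)) has_vector_derivative
        of_real (tanh u + u * (1 - (tanh u)\<^sup>2))) (at u)" for u
      by (intro has_vector_derivative_of_real has_real_derivative_x_tanh)
    show "((\<lambda>u. complex_of_real (tanh u + u * (1 - (tanh u)\<^sup>2))) has_vector_derivative
        of_real (x_tanh_deriv2 u)) (at u)" for u
      by (intro has_vector_derivative_of_real has_real_derivative_x_tanh_deriv)
    show "continuous_on UNIV (\<lambda>u. complex_of_real (x_tanh_deriv2 u))"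
      by (intro continuous_intros continuous_on_x_tanh_deriv2)
    show "norm (complex_of_real (u * tanh u)) \<le> B * exp (c * u)" if "u \<ge> 0" for u
      unfolding norm_of_real by (rule order_trans[OF G lin[OF that]])
    show "norm (complex_of_real (tanh u + u * (1 - (tanh u)\<^sup>2))) \<le> B * exp (c * u)" if "u \<ge> 0" for u
      unfolding norm_of_real by (rule order_trans[OF G' lin[OF that]])
    show "norm (complex_of_real (x_tanh_deriv2 u)) \<le> B * exp (c * u)" if "u \<ge> 0" for u
      unfolding norm_of_real by (rule order_trans[OF x_tanh_deriv2_bound lin[OF that]])
  qed (rule c)
  then show ?thesis by simp
qed

text \<open>
  The constant 1 is added because \<open>1 + tanh u = 2 / (1 + exp (- 2 u))\<close> is a plain geometric series.
\<close>

lemma x_one_plus_tanh_sums: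
  assumes "u > 0"
  shows "(\<lambda>k. 2 * (-1) ^ k * (u ^ 1 * exp (- ((t + 2 * real k) * u)))) sums (exp (- (t * u)) * (u * (1 + tanh u)))"
proof -
  define q where "q = exp (- (2 * u))"
  have q: "0 < q" "q < 1" using assms by (simp_all add: q_def)
  have "(\<lambda>k. (- q) ^ k) sums (1 / (1 - (- q)))"
    using q by (intro geometric_sums) simp
  then have "(\<lambda>k. 2 * u * exp (- (t * u)) * (- q) ^ k) sums (2 * u * exp (- (t * u)) * (1 / (1 - (- q))))"
    by (rule sums_mult)
  moreover have "2 * u * exp (- (t * u)) * (- q) ^ k = 2 * (-1) ^ k * (u ^ 1 * exp (- ((t + 2 * real k) * u)))" for k
  proof -
    have "exp (- ((t + 2 * real k) * u)) = exp (- (t * u) + real k * (- (2 * u)))"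
      by (simp add: algebra_simps)
    also have "\<dots> = exp (- (t * u)) * q ^ k"
      unfolding exp_add exp_of_nat_mult q_def ..
    finally show ?thesis by (simp add: power_minus[of q])
  qed
  moreover have "2 * u * exp (- (t * u)) * (1 / (1 - (- q))) = exp (- (t * u)) * (u * (1 + tanh u))"
  proof -
    have th: "tanh u = (1 - q) / (1 + q)" by (simp add: tanh_real_altdef q_def)
    show ?thesis unfolding th using q by (simp add: field_simps)
  qed
  ultimately show ?thesis by simp
qed

lemma summable_inverse_square_progression:
  assumes "t > 0"
  shows "summable (\<lambda>k. 1 / (t + 2 * real k)\<^sup>2)"
proof -
  have "summable (\<lambda>k. 1 / 4 * inverse ((t / 2 + real k) ^ 2))"
    using assms by (intro summable_mult Polygamma_converges') auto
  moreover have "1 / 4 * inverse ((t / 2 + real k) ^ 2) = 1 / (t + 2 * real k)\<^sup>2" for k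
  proof -
    have "1 / 4 * inverse (b ^ 2) = 1 / (2 * b)\<^sup>2" for b :: real
      by (simp add: power_mult_distrib inverse_eq_divide)
    also have "2 * (t / 2 + real k) = t + 2 * real k" by simp
    finally show ?thesis .
  qed
  ultimately show ?thesis by (simp only:)
qed

lemma laplace_x_one_plus_tanh:
  assumes t: "t > 0"
  shows "set_integrable lborel {0<..} (\<lambda>u. exp (- (t * u)) * (u * (1 + tanh u)))"
    and "(LINT u:{0<..}|lborel. exp (- (t * u)) * (u * (1 + tanh u))) = 2 * (\<Sum>k. (-1) ^ k / (t + 2 * real k)\<^sup>2)"
proof -
  define f where "f = (\<lambda>k u. indicator {0<..} u *\<^sub>R (2 * (-1) ^ k * (u ^ 1 * exp (- ((t + 2 * real k) * u)))))"
  have pos: "t + 2 * real k > 0" for k using t by (simp add: add_pos_nonneg)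
  have f_int: "integrable lborel (f k)" for k
    using set_integrable_mult_right[OF set_integrable_power_times_exp[OF pos]]
    unfolding f_def set_integrable_def by blast
  have f_value: "(LINT u|lborel. f k u) = 2 * ((-1) ^ k / (t + 2 * real k)\<^sup>2)" for k
  proof -
    have "(LINT u|lborel. f k u) = 2 * (-1) ^ k * (LINT u:{0<..}|lborel. u ^ 1 * exp (- ((t + 2 * real k) * u)))"
      unfolding f_def set_lebesgue_integral_def[symmetric] by (rule set_integral_mult_right)
    then show ?thesis
      unfolding integral_real_power_times_exp[OF pos] by (simp add: power2_eq_square)
  qed
  have f_norm: "norm (f k u) = indicator {0<..} u *\<^sub>R (2 * (u ^ 1 * exp (- ((t + 2 * real k) * u))))" for k u
    by (auto simp: f_def abs_mult indicator_def power_abs)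
  have f_norm_value: "(LINT u|lborel. norm (f k u)) = 2 * (1 / (t + 2 * real k)\<^sup>2)" for k
  proof -
    have "(LINT u|lborel. norm (f k u)) = 2 * (LINT u:{0<..}|lborel. u ^ 1 * exp (- ((t + 2 * real k) * u)))"
      unfolding f_norm set_lebesgue_integral_def[symmetric] by (rule set_integral_mult_right)
    then show ?thesis
      unfolding integral_real_power_times_exp[OF pos] by (simp add: power2_eq_square)
  qed
  have f_sums: "(\<lambda>k. f k u) sums (indicator {0<..} u *\<^sub>R (exp (- (t * u)) * (u * (1 + tanh u))))" for u
    using x_one_plus_tanh_sums[of u t] by (cases "u > 0") (simp_all add: f_def)
  have f_suminf: "(\<Sum>k. f k u) = indicator {0<..} u *\<^sub>R (exp (- (t * u)) * (u * (1 + tanh u)))" for u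
    using f_sums by (rule sums_unique[symmetric])
  have f_summable: "summable (\<lambda>k. norm (f k u))" for u
  proof (cases "u > 0")
    case True
    have "summable (\<lambda>k. 2 * u * exp (- (t * u)) * exp (- (2 * u)) ^ k)"
      using True by (intro summable_mult summable_geometric) simp
    moreover have "2 * u * exp (- (t * u)) * exp (- (2 * u)) ^ k = norm (f k u)" for k
      using True unfolding f_norm by (simp add: algebra_simps flip: exp_of_nat_mult exp_add)
    ultimately show ?thesis by (simp only:)
  qed (simp add: f_def)
  note sum_facts = f_int AE_I2[OF f_summable]
    summable_mult[OF summable_inverse_square_progression[OF t], of 2, folded f_norm_value]
  show "set_integrable lborel {0<..} (\<lambda>u. exp (- (t * u)) * (u * (1 + tanh u)))"
    unfolding set_integrable_def f_suminf[symmetric] by (rule integrable_suminf[OF sum_facts])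
  have "(LINT u:{0<..}|lborel. exp (- (t * u)) * (u * (1 + tanh u))) = (\<Sum>k. 2 * ((-1) ^ k / (t + 2 * real k)\<^sup>2))"
    unfolding set_lebesgue_integral_def f_suminf[symmetric] f_value[symmetric]
    by (rule integral_suminf[OF sum_facts])
  also have "\<dots> = 2 * (\<Sum>k. (-1) ^ k / (t + 2 * real k)\<^sup>2)"
    by (rule suminf_mult, rule summable_rabs_cancel)
       (simp add: abs_divide power_abs summable_inverse_square_progression[OF t])
  finally show "(LINT u:{0<..}|lborel. exp (- (t * u)) * (u * (1 + tanh u))) = 2 * (\<Sum>k. (-1) ^ k / (t + 2 * real k)\<^sup>2)" .
qed

lemma laplace_x_tanh_deriv2:
  assumes t: "t > 0"
  shows "laplace (\<lambda>u. of_real (x_tanh_deriv2 u)) t = of_real (2 * t\<^sup>2 * (\<Sum>k. (-1) ^ k / (t + 2 * real k)\<^sup>2) - 1)"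
proof -
  have "laplace (\<lambda>u. of_real (u * tanh u)) t
      = (LINT u:{0<..}|lborel. of_real (exp (- (t * u)) * (u * (1 + tanh u)) - u ^ 1 * exp (- (t * u))))"
    unfolding laplace_def by (rule arg_cong[where f = "set_lebesgue_integral lborel {0<..}"]) (auto simp: algebra_simps)
  also have "\<dots> = of_real (LINT u:{0<..}|lborel. exp (- (t * u)) * (u * (1 + tanh u)) - u ^ 1 * exp (- (t * u)))"
    by (rule set_integral_complex_of_real)
  also have "(LINT u:{0<..}|lborel. exp (- (t * u)) * (u * (1 + tanh u)) - u ^ 1 * exp (- (t * u)))
      = 2 * (\<Sum>k. (-1) ^ k / (t + 2 * real k)\<^sup>2) - 1 / t\<^sup>2"
    using set_integral_diff(2)[OF laplace_x_one_plus_tanh(1)[OF t] set_integrable_power_times_exp[OF t, of 1]]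
    unfolding laplace_x_one_plus_tanh(2)[OF t] integral_real_power_times_exp[OF t]
    by (simp add: power2_eq_square)
  finally have G: "laplace (\<lambda>u. of_real (u * tanh u)) t
      = of_real (2 * (\<Sum>k. (-1) ^ k / (t + 2 * real k)\<^sup>2) - 1 / t\<^sup>2)" .
  have "t\<^sup>2 * (2 * (\<Sum>k. (-1) ^ k / (t + 2 * real k)\<^sup>2) - 1 / t\<^sup>2)
      = 2 * t\<^sup>2 * (\<Sum>k. (-1) ^ k / (t + 2 * real k)\<^sup>2) - 1"
    using t by (simp add: right_diff_distrib)
  then show ?thesis
    unfolding laplace_x_tanh_deriv2_eq[OF t] G of_real_power[symmetric] of_real_mult[symmetric]
    by (rule arg_cong)
qed

lemma hurwitz_zeta_2_of_real:
  assumes "b > 0"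
  shows "hurwitz_zeta 2 (of_real b) = of_real (\<Sum>k. 1 / (b + real k)\<^sup>2)"
    and "summable (\<lambda>k. 1 / (b + real k)\<^sup>2)"
proof -
  have "summable (\<lambda>k. inverse ((b + real k)\<^sup>2))"
    using assms by (intro Polygamma_converges') auto
  then show *: "summable (\<lambda>k. 1 / (b + real k)\<^sup>2)" by (simp add: inverse_eq_divide)
  have "1 / (of_nat k + complex_of_real b) powr 2 = of_real (1 / (b + real k)\<^sup>2)" for k
  proof -
    have "of_nat k + complex_of_real b = of_real (b + real k)" by simp
    moreover have "complex_of_real (b + real k) \<noteq> 0"
      unfolding of_real_eq_0_iff using assms of_nat_0_le_iff[of k, where 'a = real] by linarith
    moreover have "complex_of_real (b + real k) powr 2 = complex_of_real (b + real k) ^ 2"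
      using powr_nat'[of "complex_of_real (b + real k)" 2] by simp
    ultimately show ?thesis
      by (simp only: of_real_divide of_real_power of_real_1)
  qed
  then show "hurwitz_zeta 2 (of_real b) = of_real (\<Sum>k. 1 / (b + real k)\<^sup>2)"
    unfolding hurwitz_zeta_def using * by (simp add: suminf_of_real del: of_real_add)
qed

text \<open>
  The alternating series is twice its even part minus the series without signs; these have steps 4 and 2.
\<close>

lemma alternating_sum_eq_hurwitz_zeta:
  assumes t: "t > 0"
  shows "of_real (2 * t\<^sup>2 * (\<Sum>k. (-1) ^ k / (t + 2 * real k)\<^sup>2))
    = of_real t ^ 2 / 4 * hurwitz_zeta 2 (of_real t / 4) - of_real t ^ 2 / 2 * hurwitz_zeta 2 (of_real t / 2)"
proof -
  define a where "a = (\<lambda>k. 1 / (t + 2 * real k)\<^sup>2)"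
  have all: "a sums ((\<Sum>k. 1 / (t / 2 + real k)\<^sup>2) / 4)"
  proof -
    have "(\<lambda>k. 1 / (t / 2 + real k)\<^sup>2 / 4) sums ((\<Sum>k. 1 / (t / 2 + real k)\<^sup>2) / 4)"
      using hurwitz_zeta_2_of_real(2)[of "t / 2"] t by (intro sums_divide summable_sums) auto
    moreover have "1 / (t / 2 + real k)\<^sup>2 / 4 = a k" for k
    proof -
      have "1 / b\<^sup>2 / 4 = 1 / (2 * b)\<^sup>2" for b :: real
        by (simp add: power_mult_distrib)
      also have "2 * (t / 2 + real k) = t + 2 * real k" by simp
      finally show ?thesis unfolding a_def .
    qed
    ultimately show ?thesis by simp
  qed
  have "(\<lambda>k. 1 / (t / 4 + real k)\<^sup>2 / 16) sums ((\<Sum>k. 1 / (t / 4 + real k)\<^sup>2) / 16)"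
    using hurwitz_zeta_2_of_real(2)[of "t / 4"] t by (intro sums_divide summable_sums) auto
  moreover have "1 / (t / 4 + real k)\<^sup>2 / 16 = (if even (2 * k) then a (2 * k) else 0)" for k
  proof -
    have "1 / b\<^sup>2 / 16 = 1 / (4 * b)\<^sup>2" for b :: real
      by (simp add: power_mult_distrib)
    also have "4 * (t / 4 + real k) = t + 2 * real (2 * k)" by simp
    finally show ?thesis unfolding a_def by simp
  qed
  ultimately have "(\<lambda>k. if even (2 * k) then a (2 * k) else 0) sums ((\<Sum>k. 1 / (t / 4 + real k)\<^sup>2) / 16)"
    by simp
  then have evens: "(\<lambda>k. if even k then a k else 0) sums ((\<Sum>k. 1 / (t / 4 + real k)\<^sup>2) / 16)"
  proof (rule sums_mono_reindex[THEN iffD1, rotated 2])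
    show "strict_mono (\<lambda>k::nat. 2 * k)" by (simp add: strict_mono_def)
    show "(if even k then a k else 0) = 0" if "k \<notin> range ((*) 2)" for k
      using that by (auto elim!: evenE)
  qed
  have "(\<lambda>k. 2 * (if even k then a k else 0) - a k) sums
      (2 * ((\<Sum>k. 1 / (t / 4 + real k)\<^sup>2) / 16) - (\<Sum>k. 1 / (t / 2 + real k)\<^sup>2) / 4)"
    by (intro sums_diff sums_mult evens all)
  moreover have "2 * (if even k then a k else 0) - a k = (-1) ^ k / (t + 2 * real k)\<^sup>2" for k
    by (simp add: a_def)
  ultimately have S: "(\<Sum>k. (-1) ^ k / (t + 2 * real k)\<^sup>2)
      = (\<Sum>k. 1 / (t / 4 + real k)\<^sup>2) / 8 - (\<Sum>k. 1 / (t / 2 + real k)\<^sup>2) / 4"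
    by (simp add: sums_iff)
  have H: "hurwitz_zeta 2 (of_real t / 4) = of_real (\<Sum>k. 1 / (t / 4 + real k)\<^sup>2)"
    "hurwitz_zeta 2 (of_real t / 2) = of_real (\<Sum>k. 1 / (t / 2 + real k)\<^sup>2)"
    using hurwitz_zeta_2_of_real(1)[of "t / 4"] hurwitz_zeta_2_of_real(1)[of "t / 2"] t by simp_all
  show ?thesis unfolding S H by (simp add: algebra_simps)
qed

section \<open>Catalan's constant\<close>

lemma catalan_sums: "(\<lambda>k. (-1) ^ k / (2 * real k + 1)\<^sup>2) sums catalan_const"
proof -
  have "summable (\<lambda>k. \<bar>(-1) ^ k / (2 * real k + 1)\<^sup>2\<bar>)"
    using summable_inverse_square_progression[of 1] by (simp add: abs_divide power_abs add.commute)
  then show ?thesis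
    unfolding catalan_const_def by (rule summable_sums[OF summable_rabs_cancel])
qed

lemma laplace_x_tanh_deriv2_1: "laplace (\<lambda>u. of_real (x_tanh_deriv2 u)) 1 = of_real (2 * catalan_const - 1)"
  using laplace_x_tanh_deriv2[of 1] by (simp add: catalan_const_def add.commute)

text \<open>
  A partial sum with half of \<open>1 / (2 n)\<^sup>2\<close> as an estimate of the remaining alternating tail. That is the next term
  evaluated half a step earlier, which makes the error of order \<open>n\<^sup>-\<^sup>4\<close>.
\<close>

definition catalan_approx :: "nat \<Rightarrow> real" where
  "catalan_approx n = (\<Sum>k<n. (-1) ^ k / (2 * real k + 1)\<^sup>2) + (-1) ^ n / (8 * (real n)\<^sup>2)"

lemma catalan_approx_tendsto: "catalan_approx \<longlonglongrightarrow> catalan_const"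
proof -
  have "(\<lambda>n. (-1) ^ n / (8 * (real n)\<^sup>2)) \<longlonglongrightarrow> 0"
  proof (rule Lim_null_comparison)
    show "\<forall>\<^sub>F n in sequentially. norm ((-1) ^ n / (8 * (real n)\<^sup>2)) \<le> 1 / (8 * (real n)\<^sup>2)"
      by (simp add: abs_divide power_abs)
    show "(\<lambda>n. 1 / (8 * (real n)\<^sup>2)) \<longlonglongrightarrow> 0" using tendsto_mult[OF tendsto_const[of "1 / 8"] tendsto_power[OF lim_inverse_n, of 2]]
      by (simp add: field_simps)
  qed
  then have "catalan_approx \<longlonglongrightarrow> catalan_const + 0"
    unfolding catalan_approx_def[abs_def] using catalan_sums unfolding sums_def by (intro tendsto_add)
  then show ?thesis by simp
qed

text \<open>
  In terms of \<open>y = x + 1\<close> the two sides are \<open>8 y / (4 (y\<^sup>2 - 1))\<^sup>2\<close> and \<open>8 y / (4 y\<^sup>2 - 1)\<^sup>2\<close>.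
\<close>

lemma catalan_approx_step_nonneg:
  fixes x :: real
  assumes "x \<ge> 1"
  shows "1 / (8 * x\<^sup>2) - 1 / (8 * (x + 2)\<^sup>2) \<ge> 1 / (2 * x + 1)\<^sup>2 - 1 / (2 * x + 3)\<^sup>2"
proof -
  define y where "y = x + 1"
  have y: "y \<ge> 2" and x: "x = y - 1" using assms by (simp_all add: y_def)
  define P Q where "P = y\<^sup>2 - 1" and "Q = 4 * y\<^sup>2 - 1"
  have "y\<^sup>2 \<ge> 2\<^sup>2" using y by (intro power_mono) auto
  then have PQ: "P > 0" "Q > 0" "4 * P \<le> Q" by (simp_all add: P_def Q_def)
  have P: "P = (y - 1) * (y + 1)" and Q: "Q = (2 * y - 1) * (2 * y + 1)"
    by (simp_all add: P_def Q_def algebra_simps power2_eq_square)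
  have diff: "1 / a\<^sup>2 - 1 / b\<^sup>2 = (b\<^sup>2 - a\<^sup>2) / (a * b)\<^sup>2" if "a \<noteq> 0" "b \<noteq> 0" for a b :: real
    using that by (simp add: field_simps)
  have "1 / (2 * x + 1)\<^sup>2 - 1 / (2 * x + 3)\<^sup>2 = 1 / (2 * y - 1)\<^sup>2 - 1 / (2 * y + 1)\<^sup>2"
    by (simp add: x algebra_simps)
  also have "\<dots> = 8 * y / Q\<^sup>2"
    using y by (subst diff) (auto simp: Q power2_eq_square algebra_simps)
  also have "\<dots> \<le> 8 * y / (4 * P)\<^sup>2"
    using PQ y by (intro divide_left_mono power_mono mult_pos_pos zero_less_power) auto
  also have "\<dots> = 4 * y / P\<^sup>2 / 8"
    by (simp add: power_mult_distrib)
  also have "4 * y / P\<^sup>2 = 1 / (y - 1)\<^sup>2 - 1 / (y + 1)\<^sup>2"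
    using y by (subst diff) (auto simp: P power2_eq_square algebra_simps)
  also have "(1 / (y - 1)\<^sup>2 - 1 / (y + 1)\<^sup>2) / 8 = 1 / (8 * x\<^sup>2) - 1 / (8 * (x + 2)\<^sup>2)"
    by (simp add: x diff_divide_distrib algebra_simps)
  finally show ?thesis .
qed

lemma catalan_approx_Suc_Suc:
  "catalan_approx (Suc (Suc n)) = catalan_approx n + (-1) ^ n *
     ((1 / (2 * real n + 1)\<^sup>2 - 1 / (2 * real n + 3)\<^sup>2) - (1 / (8 * (real n)\<^sup>2) - 1 / (8 * (real n + 2)\<^sup>2)))"
  unfolding catalan_approx_def by (simp add: algebra_simps)

text \<open>
  Along even indices the corrected partial sums decrease to the limit, along odd ones they increase.
\<close>

lemma catalan_le_approx:
  assumes "even n" "n \<ge> 1"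
  shows "catalan_const \<le> catalan_approx n"
proof -
  have "decseq (\<lambda>j. catalan_approx (n + 2 * j))"
  proof (rule decseq_SucI)
    fix j
    show "catalan_approx (n + 2 * Suc j) \<le> catalan_approx (n + 2 * j)"
      using catalan_approx_Suc_Suc[of "n + 2 * j"] catalan_approx_step_nonneg[of "real (n + 2 * j)"] assms
      by simp
  qed
  moreover have "(\<lambda>j. catalan_approx (n + 2 * j)) \<longlonglongrightarrow> catalan_const"
    by (rule filterlim_compose[OF catalan_approx_tendsto]) (auto intro!: filterlim_subseq simp: strict_mono_def)
  ultimately show ?thesis using decseq_ge[of "\<lambda>j. catalan_approx (n + 2 * j)" _ 0] by simp
qed

lemma catalan_ge_approx:
  assumes "odd n"
  shows "catalan_approx n \<le> catalan_const"
proof -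
  have "n \<ge> 1" using assms by (cases n) auto
  have "incseq (\<lambda>j. catalan_approx (n + 2 * j))"
  proof (rule incseq_SucI)
    fix j
    show "catalan_approx (n + 2 * j) \<le> catalan_approx (n + 2 * Suc j)"
      using catalan_approx_Suc_Suc[of "n + 2 * j"] catalan_approx_step_nonneg[of "real (n + 2 * j)"] assms \<open>n \<ge> 1\<close>
      by simp
  qed
  moreover have "(\<lambda>j. catalan_approx (n + 2 * j)) \<longlonglongrightarrow> catalan_const"
    by (rule filterlim_compose[OF catalan_approx_tendsto]) (auto intro!: filterlim_subseq simp: strict_mono_def)
  ultimately show ?thesis using incseq_le[of "\<lambda>j. catalan_approx (n + 2 * j)" _ 0] by simp
qed

lemma catalan_bounds: "\<bar>(2 * catalan_const - 1) - 0.83193\<bar> < 0.000005"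
proof -
  \<comment> \<open>Near index 16 the error is of size \<open>10\<^sup>-\<^sup>6\<close>, less than the margins that the rounding leaves.\<close>
  have "catalan_approx 16 < 0.9159675"
    by (simp add: catalan_approx_def lessThan_nat_numeral lessThan_Suc power2_eq_square)
  moreover have "0.9159625 < catalan_approx 15"
    by (simp add: catalan_approx_def lessThan_nat_numeral lessThan_Suc power2_eq_square)
  ultimately show ?thesis
    using catalan_le_approx[of 16] catalan_ge_approx[of 15] unfolding abs_less_iff by simp
qed

section \<open>Polylogarithms\<close>

lemma polylog_series_has_field_derivative:
  fixes z :: complex
  assumes z: "norm z < 1"
  shows "\<exists>d. (polylog_series (Suc n) has_field_derivative d) (at z) \<and> z * d = polylog_series n z"
proof -
  define c :: "nat \<Rightarrow> complex" where "c = (\<lambda>k. if k = 0 then 0 else 1 / of_nat k ^ Suc n)"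
  have summ: "summable (\<lambda>k. c k * w ^ k)" if "norm w < 1" for w
  proof -
    have "summable (\<lambda>k. w * (1 / of_nat (Suc k) ^ Suc n * w ^ k))"
      by (intro summable_mult summable_polylog_coeffs that)
    then have "summable (\<lambda>k. c (Suc k) * w ^ Suc k)"
      by (simp add: c_def mult_ac del: of_nat_Suc)
    then show ?thesis by (subst summable_Suc_iff[symmetric])
  qed
  have eq: "(\<Sum>k. c k * w ^ k) = polylog_series (Suc n) w" if w: "w \<in> ball 0 1" for w
  proof -
    have "(\<Sum>k. c k * w ^ k) = (\<Sum>k. c (Suc k) * w ^ Suc k)"
      using suminf_split_head[OF summ, of w] w by (simp add: c_def)
    then show ?thesis by (simp add: c_def polylog_series_def del: of_nat_Suc power_Suc)
  qed
  have "((\<lambda>w. \<Sum>k. c k * w ^ k) has_field_derivative (\<Sum>k. diffs c k * z ^ k)) (at z)"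
    by (rule termdiffs_strong'[where K = 1]) (use z summ in auto)
  then have "(polylog_series (Suc n) has_field_derivative (\<Sum>k. diffs c k * z ^ k)) (at z)"
    by (rule has_field_derivative_transform_within_open[OF _ open_ball[of 0 1]]) (use z eq in auto)
  moreover have "z * (\<Sum>k. diffs c k * z ^ k) = polylog_series n z"
  proof -
    have "diffs c k = 1 / of_nat (Suc k) ^ n" for k
      unfolding diffs_def c_def by (simp add: field_simps del: of_nat_Suc)
    then have "z * (\<Sum>k. diffs c k * z ^ k) = (\<Sum>k. z * (1 / of_nat (Suc k) ^ n * z ^ k))"
      using suminf_mult[OF summable_polylog_coeffs[OF z, of n], of z] by simp
    then show ?thesis by (simp add: polylog_series_def del: of_nat_Suc)
  qed
  ultimately show ?thesis by blast
qed

text \<open>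
  The power series gives \<open>z Li\<^sub>n\<^sub>+\<^sub>1' z = Li\<^sub>n z\<close> on the unit disc, and analytic continuation extends it to the slit plane.
\<close>

lemma has_field_derivative_polylog:
  assumes z: "z \<in> slit_plane" "z \<noteq> 0"
  shows "(polylog (Suc n) has_field_derivative polylog n z / z) (at z)"
proof -
  have deriv: "(polylog (Suc n) has_field_derivative deriv (polylog (Suc n)) w) (at w)" if "w \<in> slit_plane" for w
    using holomorphic_derivI[OF holomorphic_polylog open_slit_plane that] .
  have "z * deriv (polylog (Suc n)) z = polylog n z"
  proof (rule analytic_continuation_open[OF open_ball[of 0 1] open_slit_plane _
        starlike_imp_connected[OF starlike_slit_plane] ball_subset_slit_plane,
        where f = "\<lambda>w. w * deriv (polylog (Suc n)) w" and g = "polylog n"])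
    show "(\<lambda>w. w * deriv (polylog (Suc n)) w) holomorphic_on slit_plane"
      by (intro holomorphic_intros holomorphic_deriv holomorphic_polylog open_slit_plane)
    show "polylog n holomorphic_on slit_plane" by (rule holomorphic_polylog)
    show "w * deriv (polylog (Suc n)) w = polylog n w" if "w \<in> ball 0 1" for w
    proof -
      have w: "norm w < 1" using that by simp
      obtain d where d: "(polylog_series (Suc n) has_field_derivative d) (at w)" "w * d = polylog_series n w"
        using polylog_series_has_field_derivative[OF w] by blast
      have "(polylog (Suc n) has_field_derivative d) (at w)"
        by (rule has_field_derivative_transform_within_open[OF d(1) open_ball[of 0 1]])
           (use that polylog_eq_series in auto)
      then show ?thesis
        using d(2) DERIV_imp_deriv polylog_eq_series[OF w] by metis
    qed
  qed (use z in auto)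
  then have "deriv (polylog (Suc n)) z = polylog n z / z"
    using z by (simp add: field_simps)
  then show ?thesis using deriv[OF z(1)] by simp
qed

lemma polylog_1:
  assumes z: "z \<in> slit_plane"
  shows "polylog 1 z = - Ln (1 - z)"
proof (rule polylog_eqI[OF _ _ z])
  have "1 - w \<notin> \<real>\<^sub>\<le>\<^sub>0" if "w \<in> slit_plane" for w
  proof
    assume "1 - w \<in> \<real>\<^sub>\<le>\<^sub>0"
    then obtain r where "1 - w = of_real r" "r \<le> 0" by (elim nonpos_Reals_cases)
    then have "w = of_real (1 - r)" "1 - r \<in> {1..}" by (auto simp: algebra_simps)
    then have "w \<in> of_real ` {1..}" by (rule image_eqI)
    then show False using that by (simp add: slit_plane_def)
  qed
  then show "(\<lambda>z. - Ln (1 - z)) holomorphic_on slit_plane"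
    by (intro holomorphic_intros) auto
  fix u :: complex assume u: "u \<in> ball 0 1"
  then have "(\<lambda>n. (-1) ^ Suc n / of_nat n * (- u) ^ n) sums Ln (1 + (- u))"
    by (intro Ln_series) simp
  from sums_split_initial_segment[OF this, of 1]
  have "(\<lambda>n. (-1) ^ Suc (Suc n) / of_nat (Suc n) * (- u) ^ Suc n) sums Ln (1 - u)"
    by (simp del: of_nat_Suc power_Suc)
  from sums_minus[OF this]
  have "(\<lambda>n. - ((-1) ^ Suc (Suc n) / of_nat (Suc n) * (- u) ^ Suc n)) sums - Ln (1 - u)" .
  moreover have "- ((-1) ^ Suc (Suc n) / of_nat (Suc n) * (- u) ^ Suc n) = u ^ Suc n / of_nat (Suc n)" for n
    by (cases "even n") (simp_all add: power_minus_even power_minus_odd del: of_nat_Suc)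
  ultimately have "(\<lambda>n. u ^ Suc n / of_nat (Suc n)) sums - Ln (1 - u)"
    by (simp only:)
  then show "- Ln (1 - u) = polylog_series 1 u"
    by (simp add: polylog_series_def sums_iff del: of_nat_Suc)
qed

text \<open>
  The series converges uniformly on the closed disc, so its sum is continuous there, and the continuation is
  continuous off the cut. They agree inside the disc, hence also at the boundary points off the cut.
\<close>

lemma polylog_sums_on_closed_disc:
  assumes n: "n \<ge> 2" and z: "z \<in> slit_plane" "norm z \<le> 1"
  shows "(\<lambda>k. z ^ Suc k / of_nat (Suc k) ^ n) sums polylog n z"
proof -
  have summable_bound: "summable (\<lambda>k. inverse (real (Suc k) ^ n))"
    using inverse_power_summable[OF n] by (subst summable_Suc_iff)
  have term_bound: "norm (w ^ Suc k / of_nat (Suc k) ^ n) \<le> inverse (real (Suc k) ^ n)"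
    if "w \<in> cball 0 1" for w :: complex and k
  proof -
    have "norm w ^ Suc k \<le> 1" using that by (intro power_le_one) auto
    moreover have "norm (of_nat (Suc k) ^ n :: complex) = real (Suc k) ^ n"
      by (metis norm_of_nat norm_power)
    ultimately show ?thesis
      unfolding norm_divide norm_power[of w] by (simp add: divide_inverse mult_left_le_one_le del: of_nat_Suc power_Suc)
  qed
  have "continuous_on (cball 0 1) (polylog_series n)"
  proof (rule uniform_limit_theorem)
    show "uniform_limit (cball 0 1) (\<lambda>m w. \<Sum>k<m. w ^ Suc k / of_nat (Suc k) ^ n) (polylog_series n) sequentially"
      unfolding polylog_series_def[abs_def] using term_bound summable_bound by (rule Weierstrass_m_test)
    show "\<forall>\<^sub>F m in sequentially. continuous_on (cball 0 1) (\<lambda>w::complex. \<Sum>k<m. w ^ Suc k / of_nat (Suc k) ^ n)"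
      by (intro always_eventually allI continuous_intros) (simp del: of_nat_Suc)
  qed simp
  moreover define r where "r = (\<lambda>j. of_real (real j / real (Suc j)) * z)"
  have r_lim: "r \<longlonglongrightarrow> z"
    unfolding r_def using tendsto_mult[OF tendsto_of_real[OF LIMSEQ_n_over_Suc_n] tendsto_const, of z] by simp
  have r_ball: "norm (r j) < 1" for j
  proof -
    have "norm (r j) = real j / real (Suc j) * norm z"
      unfolding r_def norm_mult norm_of_real by simp
    also have "\<dots> \<le> real j / real (Suc j) * 1" using z by (intro mult_left_mono) auto
    also have "\<dots> < 1" by simp
    finally show ?thesis .
  qed
  ultimately have "(\<lambda>j. polylog_series n (r j)) \<longlonglongrightarrow> polylog_series n z"
    using z r_lim r_ball by (auto simp: continuous_on_sequentially o_def less_imp_le)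
  moreover have "(\<lambda>j. polylog n (r j)) \<longlonglongrightarrow> polylog n z"
  proof -
    have "isCont (polylog n) z"
      using holomorphic_on_imp_continuous_on[OF holomorphic_polylog] open_slit_plane z(1)
      by (simp add: continuous_on_eq_continuous_at)
    then show ?thesis using r_lim by (rule isCont_tendsto_compose)
  qed
  moreover have "(\<lambda>j. polylog n (r j)) = (\<lambda>j. polylog_series n (r j))"
    using polylog_eq_series[OF r_ball] by auto
  ultimately have "polylog n z = polylog_series n z"
    using LIMSEQ_unique by metis
  moreover have "summable (\<lambda>k. z ^ Suc k / of_nat (Suc k) ^ n)"
    using term_bound[of z] z by (intro summable_comparison_test'[OF summable_bound]) auto
  ultimately show ?thesis
    unfolding polylog_series_def by (simp add: summable_sums)
qed

section \<open>The inverse tangent integral\<close>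

definition dilog_part :: "real \<Rightarrow> complex" where
  "dilog_part t = \<i> * (polylog 2 (\<i> * of_real (exp t)) - polylog 2 (- \<i> * of_real (exp t)))"

lemma imaginary_in_slit_plane: "y \<noteq> 0 \<Longrightarrow> \<i> * of_real y \<in> slit_plane" "y \<noteq> 0 \<Longrightarrow> - \<i> * of_real y \<in> slit_plane"
  by (auto simp: slit_plane_def complex_eq_iff)

text \<open>
  In the difference of the two series the even powers cancel.
\<close>

lemma dilog_part_sums:
  assumes t: "t \<le> 0"
  shows "(\<lambda>k. 2 * ((-1) ^ Suc k *
            of_real (exp ((2 * real (Suc k) - 1) * t) / (2 * real (Suc k) - 1)\<^sup>2))) sums dilog_part t"
proof -
  define y where "y = exp t"
  have y: "0 < y" "y \<le> 1" using t by (simp_all add: y_def)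
  define f where "f = (\<lambda>k. \<i> * ((\<i> * of_real y) ^ Suc k / of_nat (Suc k) ^ 2 - (- \<i> * of_real y) ^ Suc k / of_nat (Suc k) ^ 2))"
  have "f sums dilog_part t"
    unfolding f_def dilog_part_def y_def[symmetric]
    using y imaginary_in_slit_plane[of y]
    by (intro sums_mult sums_diff polylog_sums_on_closed_disc) (auto simp: norm_mult)
  moreover have "f k = 0" if "k \<notin> range (\<lambda>j. 2 * j)" for k
  proof -
    have "even (Suc k)" using that by (auto elim!: evenE)
    then have "(- \<i> * complex_of_real y) ^ Suc k = (\<i> * of_real y) ^ Suc k"
      unfolding minus_mult_left[symmetric] by (rule power_minus_even)
    then show ?thesis by (simp only: f_def diff_self mult_zero_right)
  qed
  ultimately have "(\<lambda>j. f (2 * j)) sums dilog_part t"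
    by (subst sums_mono_reindex) (auto simp: strict_mono_def)
  moreover have "f (2 * j) = 2 * ((-1) ^ Suc j *
      of_real (exp ((2 * real (Suc j) - 1) * t) / (2 * real (Suc j) - 1)\<^sup>2))" for j
  proof -
    have exp_eq: "exp ((2 * real (Suc j) - 1) * t) = y ^ Suc (2 * j)"
    proof -
      have "(2 * real (Suc j) - 1) * t = real (Suc (2 * j)) * t" by simp
      then show ?thesis unfolding y_def by (simp only: exp_of_nat_mult)
    qed
    have den: "2 * real (Suc j) - 1 = real (Suc (2 * j))" by simp
    have i_pow: "\<i> * \<i> ^ Suc (2 * j) = (-1) ^ Suc j"
      by (simp add: power_mult)
    have "(- \<i> * complex_of_real y) ^ Suc (2 * j) = - ((\<i> * of_real y) ^ Suc (2 * j))"
      unfolding minus_mult_left[symmetric] by (rule power_minus_odd) simp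
    then have "f (2 * j) = 2 * ((\<i> * \<i> ^ Suc (2 * j)) * (of_real y ^ Suc (2 * j) / of_nat (Suc (2 * j)) ^ 2))"
      unfolding f_def by (simp only: power_mult_distrib) (simp add: mult_ac del: of_nat_Suc power_Suc)
    then show ?thesis
      unfolding i_pow exp_eq unfolding den by (simp del: of_nat_Suc power_Suc)
  qed
  ultimately show ?thesis by simp
qed

lemma Ln_one_plus_minus_imaginary:
  fixes y :: real
  shows "Ln (1 + \<i> * of_real y) - Ln (1 - \<i> * of_real y) = 2 * \<i> * of_real (arctan y)"
proof -
  define w where "w = 1 + \<i> * complex_of_real y"
  have w: "w \<notin> \<real>\<^sub>\<le>\<^sub>0" "w \<noteq> 0" "Re w = 1" "Im w = y" "cnj w = 1 - \<i> * of_real y"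
    by (auto simp: w_def complex_eq_iff complex_nonpos_Reals_iff)
  have "Ln w - Ln (cnj w) = of_real (2 * Im (Ln w)) * \<i>"
    unfolding cnj_Ln[OF w(1), symmetric] by (rule complex_diff_cnj)
  also have "Im (Ln w) = arctan y"
    using w Arg_eq_Im_Ln[of w] arg_conv_arctan[of w] by simp
  finally show ?thesis using w(5) by (simp add: w_def)
qed

lemma dilog_part_has_vector_derivative:
  "(dilog_part has_vector_derivative of_real (- 2 * arctan (exp t))) (at t)"
proof -
  have d: "((\<lambda>t. polylog 2 (\<epsilon> * of_real (exp t))) has_vector_derivative - Ln (1 - \<epsilon> * of_real (exp t))) (at t)"
    if \<epsilon>: "\<epsilon> * of_real (exp t) \<in> slit_plane" "\<epsilon> \<noteq> 0" for \<epsilon> :: complex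
  proof -
    have "(polylog 2 has_field_derivative polylog 1 (\<epsilon> * exp (of_real t)) / (\<epsilon> * exp (of_real t))) (at (\<epsilon> * exp (of_real t)))"
      using has_field_derivative_polylog[of "\<epsilon> * exp (of_real t)" 1] \<epsilon> by (simp add: numeral_2_eq_2 exp_of_real)
    moreover have "((\<lambda>w. \<epsilon> * exp w) has_field_derivative \<epsilon> * exp (of_real t)) (at (of_real t))"
      by (auto intro!: derivative_eq_intros)
    ultimately have "((\<lambda>w. polylog 2 (\<epsilon> * exp w)) has_field_derivative
        polylog 1 (\<epsilon> * exp (of_real t)) / (\<epsilon> * exp (of_real t)) * (\<epsilon> * exp (of_real t))) (at (of_real t))"
      by (rule DERIV_chain2)
    then have "((\<lambda>t. polylog 2 (\<epsilon> * exp (of_real t))) has_vector_derivative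
        polylog 1 (\<epsilon> * exp (of_real t)) / (\<epsilon> * exp (of_real t)) * (\<epsilon> * exp (of_real t))) (at t)"
      by (rule has_vector_derivative_real_field)
    then show ?thesis using \<epsilon> polylog_1[OF \<epsilon>(1)] by (simp add: exp_of_real)
  qed
  have "(dilog_part has_vector_derivative
      \<i> * (- Ln (1 - \<i> * of_real (exp t)) - (- Ln (1 - (- \<i>) * of_real (exp t))))) (at t)"
    unfolding dilog_part_def[abs_def]
    using imaginary_in_slit_plane[of "exp t"]
    by (intro has_vector_derivative_mult_right has_vector_derivative_diff d) auto
  also have "\<i> * (- Ln (1 - \<i> * of_real (exp t)) - (- Ln (1 - (- \<i>) * of_real (exp t))))
      = \<i> * (Ln (1 + \<i> * of_real (exp t)) - Ln (1 - \<i> * of_real (exp t)))"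
    by simp
  also have "\<dots> = \<i> * (2 * \<i> * of_real (arctan (exp t)))"
    by (simp only: Ln_one_plus_minus_imaginary)
  also have "\<dots> = of_real (- 2 * arctan (exp t))"
    by (simp add: complex_eq_iff)
  finally show ?thesis .
qed

text \<open>
  Up to a constant this is the integral of \<open>t / cosh t\<close>.
\<close>

definition sech_integral :: "real \<Rightarrow> complex" where
  "sech_integral t = dilog_part t + of_real (2 * t * arctan (exp t))"

lemma sech_integral_has_vector_derivative:
  "(sech_integral has_vector_derivative of_real (t / cosh t)) (at t)"
proof -
  have "((\<lambda>t. 2 * t * arctan (exp t)) has_real_derivative
      2 * arctan (exp t) + 2 * t * (exp t / (1 + (exp t)\<^sup>2))) (at t)"
    by (auto intro!: derivative_eq_intros simp: field_simps)
  then have "(sech_integral has_vector_derivative of_real (- 2 * arctan (exp t))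
      + of_real (2 * arctan (exp t) + 2 * t * (exp t / (1 + (exp t)\<^sup>2)))) (at t)"
    unfolding sech_integral_def[abs_def]
    by (intro has_vector_derivative_add dilog_part_has_vector_derivative has_vector_derivative_of_real)
  moreover have sech: "2 * t * (exp t / (1 + (exp t)\<^sup>2)) = t / cosh t"
  proof -
    define E where "E = exp t"
    have E: "E > 0" "1 + E\<^sup>2 > 0" by (simp_all add: E_def add_pos_nonneg)
    have "cosh t = (E + 1 / E) / 2" by (simp add: E_def cosh_field_def exp_minus inverse_eq_divide)
    also have "\<dots> = (1 + E\<^sup>2) / (2 * E)" using E by (simp add: field_simps power2_eq_square)
    finally show ?thesis using E by (simp add: E_def[symmetric])
  qed
  then have "complex_of_real (- 2 * arctan (exp t)) + of_real (2 * arctan (exp t) + 2 * t * (exp t / (1 + (exp t)\<^sup>2)))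
      = of_real (t / cosh t)"
    unfolding of_real_add[symmetric] by simp
  ultimately show ?thesis by (simp only:)
qed

text \<open>
  The derivative \<open>t / cosh t\<close> is odd.
\<close>

lemma sech_integral_even: "sech_integral (- t) = sech_integral t"
proof -
  have "((\<lambda>t. sech_integral t - sech_integral (- t)) has_vector_derivative 0) (at t)" for t
  proof -
    have "((\<lambda>t. - t) has_vector_derivative - 1) (at t)"
      by (auto intro!: derivative_eq_intros)
    from vector_diff_chain_at[OF this sech_integral_has_vector_derivative]
    have "((\<lambda>t. sech_integral (- t)) has_vector_derivative - 1 *\<^sub>R of_real (- t / cosh (- t))) (at t)"
      by (simp add: o_def)
    from has_vector_derivative_diff[OF sech_integral_has_vector_derivative this]
    show ?thesis by simp
  qed
  then obtain c where "\<And>t. sech_integral t - sech_integral (- t) = c"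
    using has_vector_derivative_zero_constant[of UNIV "\<lambda>t. sech_integral t - sech_integral (- t)"]
    by (auto simp: has_vector_derivative_at_within)
  from this[of 0] this[of t] show ?thesis by simp
qed

lemma abs_le_cosh: "\<bar>t\<bar> \<le> cosh t" for t :: real
proof -
  have "1 + \<bar>t\<bar> + \<bar>t\<bar>\<^sup>2 / 2 \<le> exp \<bar>t\<bar>" by (rule exp_lower_Taylor_quadratic) simp
  moreover have "0 \<le> (\<bar>t\<bar> - 1)\<^sup>2" by simp
  then have "2 * \<bar>t\<bar> \<le> 1 + \<bar>t\<bar>\<^sup>2" by (simp add: power2_eq_square algebra_simps)
  moreover have "cosh t = (exp \<bar>t\<bar> + exp (- \<bar>t\<bar>)) / 2"
    using cosh_real_abs[of t] by (simp add: cosh_field_def)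
  moreover have "exp (- \<bar>t\<bar>) \<ge> 0" by simp
  ultimately show ?thesis by argo
qed

text \<open>
  The derivative \<open>t / cosh t\<close> is bounded by 1.
\<close>

lemma norm_sech_integral_le:
  assumes t: "t \<ge> 0"
  shows "norm (sech_integral t) \<le> norm (sech_integral 0) + t"
proof -
  have "norm (sech_integral t - sech_integral 0) \<le> t - 0"
  proof (cases "t = 0")
    case False
    with t have "0 < t" by simp
    then show ?thesis
    proof (rule differentiable_bound_general)
      have "continuous_on UNIV sech_integral"
        using sech_integral_has_vector_derivative
        by (auto intro!: continuous_at_imp_continuous_on has_vector_derivative_continuous)
      then show "continuous_on {0..t} sech_integral" by (rule continuous_on_subset) simp
      show "norm (complex_of_real (x / cosh x)) \<le> 1" if "0 < x" for x
        unfolding norm_of_real using abs_le_cosh[of x] cosh_real_pos[of x] by (simp add: abs_divide)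
      show "(sech_integral has_vector_derivative of_real (x / cosh x)) (at x)" for x
        by (rule sech_integral_has_vector_derivative)
      show "((\<lambda>x. x) has_vector_derivative 1) (at x)" for x :: real
        by (auto intro!: derivative_eq_intros)
    qed (auto intro!: continuous_intros)
  qed simp
  then show ?thesis
    using norm_triangle_ineq[of "sech_integral 0" "sech_integral t - sech_integral 0"] by simp
qed

section \<open>The closed form of the characteristic function\<close>

lemma dilog_part_0: "dilog_part 0 = - 2 * of_real catalan_const"
proof -
  have "(\<lambda>k. - 2 * complex_of_real ((-1) ^ k / (2 * real k + 1)\<^sup>2)) sums (- 2 * of_real catalan_const)"
    by (intro sums_mult sums_of_real catalan_sums)
  moreover have "- 2 * complex_of_real ((-1) ^ k / (2 * real k + 1)\<^sup>2) = 2 * ((-1) ^ Suc k *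
            of_real (exp ((2 * real (Suc k) - 1) * 0) / (2 * real (Suc k) - 1)\<^sup>2))" for k
    by (simp add: add.commute)
  ultimately have "(\<lambda>k. 2 * ((-1) ^ Suc k *
            complex_of_real (exp ((2 * real (Suc k) - 1) * 0) / (2 * real (Suc k) - 1)\<^sup>2))) sums (- 2 * of_real catalan_const)"
    by (simp only:)
  then show ?thesis
    using dilog_part_sums[of 0] sums_unique2 by blast
qed

lemma sech_integral_0: "sech_integral 0 = - 2 * of_real catalan_const"
  by (simp add: sech_integral_def dilog_part_0)

definition closed_form :: "real \<Rightarrow> complex" where
  "closed_form t = - 1 - of_real (t * tanh t) - of_real (cosh t) * sech_integral t"

definition closed_form_deriv :: "real \<Rightarrow> complex" where
  "closed_form_deriv t = - of_real (tanh t + t * (1 - (tanh t)\<^sup>2)) - (of_real (sinh t) * sech_integral t + of_real t)"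

lemma closed_form_has_vector_derivative:
  "(closed_form has_vector_derivative closed_form_deriv t) (at t)"
proof -
  have 1: "((\<lambda>t. complex_of_real (cosh t) * sech_integral t) has_vector_derivative
      of_real (cosh t) * of_real (t / cosh t) + of_real (sinh t) * sech_integral t) (at t)"
    by (intro has_vector_derivative_mult has_vector_derivative_of_real sech_integral_has_vector_derivative)
       (auto intro!: derivative_eq_intros)
  have 2: "((\<lambda>t. - 1 - complex_of_real (t * tanh t)) has_vector_derivative
      0 - of_real (tanh t + t * (1 - (tanh t)\<^sup>2))) (at t)"
    by (intro has_vector_derivative_diff has_vector_derivative_const has_vector_derivative_of_real has_real_derivative_x_tanh)
  have "(closed_form has_vector_derivative 0 - of_real (tanh t + t * (1 - (tanh t)\<^sup>2))
      - (of_real (cosh t) * of_real (t / cosh t) + of_real (sinh t) * sech_integral t)) (at t)"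
    unfolding closed_form_def[abs_def] by (rule has_vector_derivative_diff[OF 2 1])
  moreover have "0 - of_real (tanh t + t * (1 - (tanh t)\<^sup>2))
      - (of_real (cosh t) * of_real (t / cosh t) + of_real (sinh t) * sech_integral t) = closed_form_deriv t"
    by (simp add: closed_form_deriv_def)
  ultimately show ?thesis by (simp only:)
qed

text \<open>
  The closed form is a solution \<open>\<phi>\<close> of \<open>\<phi>'' = \<phi> - (t tanh t)''\<close>: the terms without \<open>sech_integral\<close> that arise from the
  product rule are \<open>t tanh t + 1\<close>, which the closed form contains.
\<close>

lemma closed_form_deriv_has_vector_derivative:
  "(closed_form_deriv has_vector_derivative closed_form t - of_real (x_tanh_deriv2 t)) (at t)"
proof -
  have 1: "((\<lambda>t. complex_of_real (sinh t) * sech_integral t + of_real t) has_vector_derivative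
      (of_real (sinh t) * of_real (t / cosh t) + of_real (cosh t) * sech_integral t) + of_real 1) (at t)"
    by (intro has_vector_derivative_add has_vector_derivative_mult has_vector_derivative_of_real sech_integral_has_vector_derivative)
       (auto intro!: derivative_eq_intros)
  have 2: "((\<lambda>t. - complex_of_real (tanh t + t * (1 - (tanh t)\<^sup>2))) has_vector_derivative
      - of_real (x_tanh_deriv2 t)) (at t)"
    by (intro has_vector_derivative_minus has_vector_derivative_of_real has_real_derivative_x_tanh_deriv)
  have "(closed_form_deriv has_vector_derivative - of_real (x_tanh_deriv2 t)
      - ((of_real (sinh t) * of_real (t / cosh t) + of_real (cosh t) * sech_integral t) + of_real 1)) (at t)"
    unfolding closed_form_deriv_def[abs_def] by (rule has_vector_derivative_diff[OF 2 1])
  moreover have "- of_real (x_tanh_deriv2 t)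
      - ((of_real (sinh t) * of_real (t / cosh t) + of_real (cosh t) * sech_integral t) + of_real 1)
      = closed_form t - of_real (x_tanh_deriv2 t)"
    by (simp add: closed_form_def tanh_def)
  ultimately show ?thesis by (simp only:)
qed

lemma closed_form_0: "closed_form 0 = of_real (2 * catalan_const - 1)" "closed_form_deriv 0 = 0"
  by (simp_all add: closed_form_def closed_form_deriv_def sech_integral_0)

lemma closed_form_even: "closed_form (- t) = closed_form t"
  by (simp add: closed_form_def sech_integral_even)

text \<open>
  Only finite exponential growth matters here, as it makes the Laplace transform available for \<open>s > 2\<close>; the exponent 2
  comes from \<open>cosh u\<close> times a linearly growing function.
\<close>

lemma closed_form_bounds:
  obtains B where
    "\<And>u. u \<ge> 0 \<Longrightarrow> norm (closed_form u) \<le> B * exp (2 * u)"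
    "\<And>u. u \<ge> 0 \<Longrightarrow> norm (closed_form_deriv u) \<le> B * exp (2 * u)"
    "\<And>u. u \<ge> 0 \<Longrightarrow> norm (closed_form u - of_real (x_tanh_deriv2 u)) \<le> B * exp (2 * u)"
proof -
  define A where "A = norm (sech_integral 0)"
  have A: "A \<ge> 0" by (simp add: A_def)
  define B where "B = A + 6"
  have bounds: "norm (closed_form u) \<le> (A + 3) * exp (2 * u)"
    "norm (closed_form_deriv u) \<le> B * exp (2 * u)"
    "norm (complex_of_real (x_tanh_deriv2 u)) \<le> 2 * exp (2 * u)" if u: "u \<ge> 0" for u
  proof -
    define E where "E = exp u"
    have E1: "1 + u \<le> E" unfolding E_def by (rule exp_ge_add_one_self)
    then have "E * 1 \<le> E * E" using u by (intro mult_left_mono) auto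
    with E1 u have E: "1 + u \<le> E" "1 \<le> E" "u \<le> E" "E \<le> E\<^sup>2"
      by (simp_all add: power2_eq_square)
    have E2: "exp (2 * u) = E\<^sup>2" by (simp add: E_def exp_double)
    have hyp: "0 \<le> cosh u" "cosh u \<le> E" "0 \<le> sinh u" "sinh u \<le> E"
      using exp_gt_zero[of "- u"] exp_gt_zero[of u] u
      unfolding cosh_field_def sinh_field_def E_def by (simp_all del: exp_gt_zero)
    have "norm (sech_integral u) \<le> A + u"
      using norm_sech_integral_le[OF u] by (simp add: A_def)
    also have "\<dots> \<le> (A + 1) * E"
      using mult_left_mono[OF E(2) A] E(3) by (simp add: algebra_simps)
    finally have S: "norm (sech_integral u) \<le> (A + 1) * E" .
    have prod: "norm (complex_of_real c * sech_integral u) \<le> (A + 1) * E\<^sup>2" if "0 \<le> c" "c \<le> E" for c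
    proof -
      have "norm (complex_of_real c * sech_integral u) \<le> E * ((A + 1) * E)"
        unfolding norm_mult using S that E A by (intro mult_mono) auto
      then show ?thesis by (simp add: power2_eq_square mult_ac)
    qed
    have G: "norm (complex_of_real (u * tanh u)) \<le> E"
      using mult_left_mono[OF abs_tanh_le_1[of u], of u] u E(3) by (simp add: abs_mult norm_mult)
    have G': "norm (complex_of_real (tanh u + u * (1 - (tanh u)\<^sup>2))) \<le> 1 + u"
    proof -
      have "u * (1 - (tanh u)\<^sup>2) \<le> u * 1"
        using sech_squared_bounds(2)[of u] u by (rule mult_left_mono)
      moreover have "0 \<le> u * (1 - (tanh u)\<^sup>2)"
        using u sech_squared_bounds(1)[of u] by (rule mult_nonneg_nonneg)
      moreover have "\<bar>a + b\<bar> \<le> 1 + u" if "\<bar>a\<bar> \<le> 1" "b \<le> u * 1" "0 \<le> b" for a b :: real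
        using that by linarith
      ultimately show ?thesis using abs_tanh_le_1[of u] unfolding norm_of_real by blast
    qed
    have "norm (closed_form u) \<le> 1 + norm (complex_of_real (u * tanh u)) + norm (complex_of_real (cosh u) * sech_integral u)"
    proof -
      have "norm (- 1 - x - y) \<le> 1 + norm x + norm y" for x y :: complex
        using norm_triangle_ineq4[of "- 1 - x" y] norm_triangle_ineq4[of "- 1" x] by simp
      then show ?thesis unfolding closed_form_def .
    qed
    also have "\<dots> \<le> (A + 3) * E\<^sup>2"
      using prod[OF hyp(1,2)] G E by (simp add: algebra_simps)
    finally show "norm (closed_form u) \<le> (A + 3) * exp (2 * u)" by (simp add: E2)
    have "norm (closed_form_deriv u) \<le> norm (complex_of_real (tanh u + u * (1 - (tanh u)\<^sup>2)))
        + (norm (complex_of_real (sinh u) * sech_integral u) + norm (complex_of_real u))"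
    proof -
      have "norm (- x - (y + z)) \<le> norm x + (norm y + norm z)" for x y z :: complex
        using norm_triangle_ineq4[of "- x" "y + z"] norm_triangle_ineq[of y z] by simp
      then show ?thesis unfolding closed_form_deriv_def .
    qed
    also have "\<dots> \<le> (1 + u) + ((A + 1) * E\<^sup>2 + u)"
      using prod[OF hyp(3,4)] G' u by (intro add_mono) auto
    also have "\<dots> \<le> B * E\<^sup>2"
      using E by (simp add: B_def algebra_simps)
    finally show "norm (closed_form_deriv u) \<le> B * exp (2 * u)" by (simp add: E2)
    have "\<bar>x_tanh_deriv2 u\<bar> \<le> 2 * E\<^sup>2"
      using x_tanh_deriv2_bound[of u] u E by simp
    then show "norm (complex_of_real (x_tanh_deriv2 u)) \<le> 2 * exp (2 * u)" by (simp add: E2)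
  qed
  show ?thesis
  proof (rule that[of B])
    fix u :: real assume u: "u \<ge> 0"
    have "(A + 3) * exp (2 * u) \<le> B * exp (2 * u)"
      by (intro mult_right_mono) (simp_all add: B_def)
    then show "norm (closed_form u) \<le> B * exp (2 * u)"
      using bounds(1)[OF u] by linarith
    show "norm (closed_form_deriv u) \<le> B * exp (2 * u)" by (rule bounds(2)[OF u])
    have "norm (closed_form u - of_real (x_tanh_deriv2 u)) \<le> (A + 3) * exp (2 * u) + 2 * exp (2 * u)"
      by (rule order_trans[OF norm_triangle_ineq4 add_mono[OF bounds(1)[OF u] bounds(3)[OF u]]])
    also have "\<dots> \<le> B * exp (2 * u)" by (simp add: B_def algebra_simps)
    finally show "norm (closed_form u - of_real (x_tanh_deriv2 u)) \<le> B * exp (2 * u)" .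
  qed
qed

lemma continuous_on_closed_form: "continuous_on UNIV closed_form"
  using closed_form_has_vector_derivative
  by (auto intro!: continuous_at_imp_continuous_on has_vector_derivative_continuous)

text \<open>
  The differential equation of the closed form, transformed.
\<close>

lemma laplace_closed_form:
  assumes s: "s > 2"
  shows "(1 - of_real s ^ 2) * laplace closed_form s
    = laplace (\<lambda>u. of_real (x_tanh_deriv2 u)) s - of_real (s * (2 * catalan_const - 1))"
proof -
  obtain B where B:
    "\<And>u. u \<ge> 0 \<Longrightarrow> norm (closed_form u) \<le> B * exp (2 * u)"
    "\<And>u. u \<ge> 0 \<Longrightarrow> norm (closed_form_deriv u) \<le> B * exp (2 * u)"
    "\<And>u. u \<ge> 0 \<Longrightarrow> norm (closed_form u - of_real (x_tanh_deriv2 u)) \<le> B * exp (2 * u)"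
    using closed_form_bounds by blast
  have "laplace (\<lambda>u. closed_form u - of_real (x_tanh_deriv2 u)) s
      = of_real s ^ 2 * laplace closed_form s - of_real s * closed_form 0 - closed_form_deriv 0"
    by (rule laplace_second_derivative[OF closed_form_has_vector_derivative closed_form_deriv_has_vector_derivative _ B s])
       (intro continuous_intros continuous_on_closed_form continuous_on_x_tanh_deriv2)
  moreover have "laplace (\<lambda>u. closed_form u - of_real (x_tanh_deriv2 u)) s
      = laplace closed_form s - laplace (\<lambda>u. of_real (x_tanh_deriv2 u)) s"
  proof -
    have 1: "set_integrable lborel {0<..} (\<lambda>u. of_real (exp (- (s * u))) * closed_form u)"
      using B(1) s by (intro set_integrable_laplace[where c = 2 and B = B] continuous_on_closed_form) auto
    have 2: "set_integrable lborel {0<..} (\<lambda>u. of_real (exp (- (s * u))) * (closed_form u - of_real (x_tanh_deriv2 u)))"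
      using B(3) s by (intro set_integrable_laplace[where c = 2 and B = B] continuous_intros continuous_on_closed_form continuous_on_x_tanh_deriv2) auto
    have "set_integrable lborel {0<..} (\<lambda>u. of_real (exp (- (s * u))) * of_real (x_tanh_deriv2 u) :: complex)"
      using set_integral_diff(1)[OF 1 2] by (simp add: right_diff_distrib)
    then show ?thesis
      unfolding laplace_def right_diff_distrib by (rule set_integral_diff(2)[OF 1])
  qed
  ultimately show ?thesis
    unfolding closed_form_0 by (simp add: algebra_simps)
qed

lemma measure_spectral_measure: "measure spectral_measure UNIV = 2 * catalan_const - 1"
proof -
  interpret finite_borel_measure spectral_measure by (rule finite_borel_spectral_measure)
  have "- \<i> * of_real (measure spectral_measure UNIV) = - \<i> * laplace (\<lambda>u. of_real (x_tanh_deriv2 u)) 1"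
    using representation_integral[of 1] spectral_representation_integral[of 1] by simp
  then have "complex_of_real (measure spectral_measure UNIV) = of_real (2 * catalan_const - 1)"
    unfolding laplace_x_tanh_deriv2_1 by (metis complex_i_not_zero mult_cancel_left neg_equal_0_iff_equal)
  then show ?thesis unfolding of_real_eq_iff .
qed

lemma laplace_char_spectral_measure:
  assumes t: "t > 0"
  shows "(1 - of_real t ^ 2) * laplace (char spectral_measure) t
    = laplace (\<lambda>u. of_real (x_tanh_deriv2 u)) t - of_real (t * (2 * catalan_const - 1))"
proof -
  interpret finite_borel_measure spectral_measure by (rule finite_borel_spectral_measure)
  define L where "L = laplace (\<lambda>u. of_real (x_tanh_deriv2 u)) t"
  have L_real: "cnj L = L" unfolding L_def laplace_x_tanh_deriv2[OF t] by (rule complex_cnj_complex_of_real)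
  have "- \<i> * L = - (\<i> * of_real t) * of_real (2 * catalan_const - 1)
      - \<i> * (1 - of_real t ^ 2) * cnj (laplace (char spectral_measure) t)"
    using representation_integral[OF t] spectral_representation_integral[OF t]
    unfolding L_def measure_spectral_measure by simp
  then have "(- \<i>) * L = (- \<i>) * (of_real (t * (2 * catalan_const - 1))
      + (1 - of_real t ^ 2) * cnj (laplace (char spectral_measure) t))"
    by (simp add: algebra_simps)
  then have "L = of_real (t * (2 * catalan_const - 1))
      + (1 - of_real t ^ 2) * cnj (laplace (char spectral_measure) t)"
    by (metis complex_i_not_zero mult_cancel_left neg_equal_0_iff_equal)
  from arg_cong[OF this, of cnj] show ?thesis
    unfolding L_def[symmetric] by (simp add: L_real)
qed

text \<open>
  The two Laplace transforms agree beyond 2. This settles \<open>t \<ge> 0\<close>, and both functions are even.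
\<close>

lemma char_spectral_measure_closed_form: "char spectral_measure t = closed_form t"
proof -
  interpret finite_borel_measure spectral_measure by (rule finite_borel_spectral_measure)
  define M where "M = measure spectral_measure UNIV"
  obtain B where B: "\<And>u. u \<ge> 0 \<Longrightarrow> norm (closed_form u) \<le> B * exp (2 * u)"
  proof (rule closed_form_bounds)
    fix B assume "\<And>u. u \<ge> 0 \<Longrightarrow> norm (closed_form u) \<le> B * exp (2 * u)"
    then show ?thesis by (rule that)
  qed
  have bound: "norm (char spectral_measure u) \<le> M * exp (2 * u)" if "u \<ge> 0" for u
  proof -
    have "norm (char spectral_measure u) \<le> M * 1" using norm_char_le[of u] by (simp add: M_def)
    also have "\<dots> \<le> M * exp (2 * u)" using that by (intro mult_left_mono) (simp_all add: M_def)
    finally show ?thesis .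
  qed
  have eq: "char spectral_measure u - closed_form u = 0" if u: "u \<ge> 0" for u
  proof (rule laplace_eq_0_imp_eq_0[OF _ _ _ u])
    show "continuous_on UNIV (\<lambda>u. char spectral_measure u - closed_form u)"
      by (intro continuous_intros continuous_on_char continuous_on_closed_form)
    show "norm (char spectral_measure u - closed_form u) \<le> (M + B) * exp (2 * u)" if "u \<ge> 0" for u
      unfolding distrib_right
      by (rule order_trans[OF norm_triangle_ineq4 add_mono[OF bound[OF that] B[OF that]]])
    fix n
    define s where "s = 2 + real (Suc n)"
    have s: "s > 2" by (simp add: s_def)
    have ne: "1 - complex_of_real s ^ 2 \<noteq> 0"
    proof
      assume "1 - complex_of_real s ^ 2 = 0"
      then have "complex_of_real (s ^ 2) = of_real 1" by simp
      then have "s ^ 2 = 1" unfolding of_real_eq_iff .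
      then show False using s by (simp add: power2_eq_1_iff)
    qed
    have "(1 - complex_of_real s ^ 2) * laplace (char spectral_measure) s = (1 - of_real s ^ 2) * laplace closed_form s"
      unfolding laplace_closed_form[OF s] using s by (intro laplace_char_spectral_measure) simp
    then have "laplace (char spectral_measure) s = laplace closed_form s" using ne by simp
    moreover have "laplace (\<lambda>u. char spectral_measure u - closed_form u) s
        = laplace (char spectral_measure) s - laplace closed_form s"
    proof -
      have 1: "set_integrable lborel {0<..} (\<lambda>u. of_real (exp (- (s * u))) * char spectral_measure u)"
        using bound s by (intro set_integrable_laplace[where c = 2 and B = M] continuous_on_char) auto
      have 2: "set_integrable lborel {0<..} (\<lambda>u. of_real (exp (- (s * u))) * closed_form u)"
        using B s by (intro set_integrable_laplace[where c = 2 and B = B] continuous_on_closed_form) auto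
      show ?thesis unfolding laplace_def right_diff_distrib by (rule set_integral_diff(2)[OF 1 2])
    qed
    ultimately show "laplace (\<lambda>u. char spectral_measure u - closed_form u) (2 + real (Suc n)) = 0"
      by (simp add: s_def)
  qed
  show ?thesis
  proof (cases "t \<ge> 0")
    case True
    then show ?thesis using eq[of t] by simp
  next
    case False
    then have "char spectral_measure (- t) = closed_form t"
      using eq[of "- t"] by (simp add: closed_form_even)
    moreover have "char spectral_measure t = cnj (char spectral_measure (- t))"
      using char_uminus[of "- t"] by simp
    moreover have "cnj (char spectral_measure (- t)) = char spectral_measure (- t)"
      unfolding char_spectral_measure by (rule complex_cnj_complex_of_real)
    ultimately show ?thesis by simp
  qed
qed

theorem proposition4:
  fixes V :: "complex \<Rightarrow> complex"
  assumes V_free_id: "free_id_voiculescu_transform V"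
    and V_eq: "\<And>t::real. t > 0 \<Longrightarrow>
      V (\<i> * of_real t) =
        \<i> * ((of_real t)\<^sup>2 / 2 * hurwitz_zeta 2 (of_real t / 2)
           - (of_real t)\<^sup>2 / 4 * hurwitz_zeta 2 (of_real t / 4) + 1)"
  shows
    "(\<exists>a m. voiculescu_representation V a m) \<and>
     (\<forall>a m. voiculescu_representation V a m \<longrightarrow>
        a = 0 \<and>
        measure m UNIV = 2 * catalan_const - 1 \<and>
        (\<forall>t::real.
           char m t =
             - 1 - of_real (t * tanh t)
             - of_real (cosh t) *
                 (\<i> * (polylog 2 (\<i> * of_real (exp t)) - polylog 2 (- \<i> * of_real (exp t)))
                  + of_real (2 * t * arctan (exp t))) \<and>
           char m t =
             of_real (pi / 2 *
               (LBINT x:{0<..}. cos (t * x) * (x\<^sup>2 / (1 + x\<^sup>2))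
                  * (cosh (pi * x / 2) / (sinh (pi * x / 2))\<^sup>2))))) \<and>
     \<bar>(2 * catalan_const - 1) - 0.83193\<bar> < 0.000005 \<and>
     (\<forall>t::real. t \<le> 0 \<longrightarrow>
        (\<lambda>k. 2 * ((-1) ^ Suc k *
               of_real (exp ((2 * real (Suc k) - 1) * t) / (2 * real (Suc k) - 1)\<^sup>2)))
          sums (\<i> * (polylog 2 (\<i> * of_real (exp t)) - polylog 2 (- \<i> * of_real (exp t))))) \<and>
     \<i> * (polylog 2 \<i> - polylog 2 (- \<i>)) = - 2 * of_real catalan_const"
proof -
  have rep: "voiculescu_representation V 0 spectral_measure"
  proof (rule voiculescu_representation_spectral_measure)
    fix t :: real assume t: "t > 0"
    have lap: "laplace (\<lambda>u. of_real (x_tanh_deriv2 u)) t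
        = of_real t ^ 2 / 4 * hurwitz_zeta 2 (of_real t / 4) - of_real t ^ 2 / 2 * hurwitz_zeta 2 (of_real t / 2) - 1"
      unfolding laplace_x_tanh_deriv2[OF t] of_real_diff alternating_sum_eq_hurwitz_zeta[OF t] by simp
    show "V (\<i> * of_real t) = - \<i> * laplace (\<lambda>u. of_real (x_tanh_deriv2 u)) t"
      unfolding V_eq[OF t] lap by (simp add: algebra_simps)
    have "V (cnj (\<i> * of_real t)) = cnj (V (\<i> * of_real t))"
    proof -
      have "\<forall>z. Im z \<noteq> 0 \<longrightarrow> V (cnj z) = cnj (V z)"
        using V_free_id unfolding free_id_voiculescu_transform_def by blast
      from this[rule_format, of "\<i> * of_real t"] t show ?thesis by simp
    qed
    then show "V (- (\<i> * of_real t)) = cnj (V (\<i> * of_real t))" by simp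
  qed
  have unique: "a = 0" "measure m UNIV = 2 * catalan_const - 1" "char m = char spectral_measure"
    if "voiculescu_representation V a m" for a m
    using voiculescu_representation_unique[OF that rep] measure_spectral_measure by auto
  have closed: "char m t = - 1 - of_real (t * tanh t) - of_real (cosh t) *
      (\<i> * (polylog 2 (\<i> * of_real (exp t)) - polylog 2 (- \<i> * of_real (exp t))) + of_real (2 * t * arctan (exp t)))"
    if "voiculescu_representation V a m" for a m t
    unfolding unique(3)[OF that] char_spectral_measure_closed_form closed_form_def sech_integral_def dilog_part_def ..
  have integral: "char m t = of_real (pi / 2 * (LBINT x:{0<..}. cos (t * x) * (x\<^sup>2 / (1 + x\<^sup>2))
      * (cosh (pi * x / 2) / (sinh (pi * x / 2))\<^sup>2)))"
    if "voiculescu_representation V a m" for a m t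
    unfolding unique(3)[OF that] by (rule char_spectral_measure)
  have "\<i> * (polylog 2 \<i> - polylog 2 (- \<i>)) = - 2 * of_real catalan_const"
    using dilog_part_0 by (simp add: dilog_part_def)
  then show ?thesis
    using rep unique(1,2) closed integral catalan_bounds dilog_part_sums[unfolded dilog_part_def]
    by (intro conjI allI impI exI[of _ "0::real"] exI[of _ spectral_measure]; blast)
qed

end
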